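(* There exists a constant $C>0$ such that for all $n\ge 1$ and all $\varepsilon\in(0,1)$, the set $\mathcal S_2$ consisting of the $\big\lceil C\sqrt{\log(1/\varepsilon)/\varepsilon}\,\big\rceil$ vertices of the uniform random recursive tree $T_n$ with largest Jordan-2 centrality (all vertices, if this number exceeds $n$; ties broken uniformly at random, i.e. the vertices $u$ with $\widehat\sigma_2(u)\le\lceil C\sqrt{\log(1/\varepsilon)/\varepsilon}\rceil$) contains vertex $1$ with probability at least $1-\varepsilon$.
   Context: The uniform random recursive tree $T_n$ on vertex set $\{1,\dots,n\}$ is sampled recursively: $T_1$ is the single vertex $1$ (the root); given $T_n$, choose $u\in\{1,\dots,n\}$ uniformly at random, independently of $T_1,\dots,T_n$, and add a new vertex $n+1$ together with the edge $\{u,n+1\}$. For a finite tree $t$ and vertices $u,v$, let $(t,u)_{v\downarrow}$ be the subtree of $v$ in the tree $t$ rooted at $u$ (the vertices $w$ such that $v$ lies on the path from $u$ to $w$), and $|\cdot|$ its number of vertices. The Jordan centrality is $\phi_t(v)=\min_{u\sim v}|(t,u)_{v\downarrow}|$, the minimum being over neighbors $u$ of $v$ in $t$. Let $v^{(1)}=\arg\min_{u\sim v}|(t,u)_{v\downarrow}|$. The Jordan-2 centrality is $$\phi_t^{(2)}(v)=\phi_t(v)\cdot\max\big(\phi_t(v^{(1)}),\phi_t(v)\big);$$ if $v^{(1)}$ is not uniquely defined, it is chosen among the minimizers so that the resulting value of $\phi^{(2)}_t(v)$ is smallest. The Jordan-2 ordering $\widehat\sigma_2$ ranks the vertices of $T_n$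 decreasingly by $\phi^{(2)}_{T_n}$ (largest value gets rank $1$), breaking ties uniformly at random; for $n=1$ the only vertex has rank $1$. *)

theory Defs
  imports "HOL-Probability.Probability"
begin

datatype 'a graph = Graph (verts: "'a set") (edges: "'a set set")

definition neighbors :: "'a graph \<Rightarrow> 'a \<Rightarrow> 'a set" where
  "neighbors t v = {u \<in> verts t. {u, v} \<in> edges t}"

definition is_path :: "'a graph \<Rightarrow> 'a \<Rightarrow> 'a list \<Rightarrow> 'a \<Rightarrow> bool" where
  "is_path t u p w \<longleftrightarrow>
     p \<noteq> [] \<and> hd p = u \<and> last p = w \<and> distinct p \<and> set p \<subseteq> verts t \<and>
     successively (\<lambda>x y. {x, y} \<in> edges t) p"

(* The vertex set of the subtree of v in t rooted at u, to be used for trees t only: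
   there the path from u to w is unique. *)
definition subtree :: "'a graph \<Rightarrow> 'a \<Rightarrow> 'a \<Rightarrow> 'a set" where
  "subtree t u v = {w \<in> verts t. \<exists>p. is_path t u p w \<and> v \<in> set p}"

(* For the tree with a single vertex the minimum is over the empty set, so the value is
   unspecified there (also in jordan2); the orderings below do not depend on it. *)
definition jordan :: "'a graph \<Rightarrow> 'a \<Rightarrow> nat" where
  "jordan t v = Min ((\<lambda>u. card (subtree t u v)) ` neighbors t v)"

definition jordan_minimizers :: "'a graph \<Rightarrow> 'a \<Rightarrow> 'a set" where
  "jordan_minimizers t v = {u \<in> neighbors t v. card (subtree t u v) = jordan t v}"

(* If there are several minimizers, the one giving the smallest value is used. *)
definition jordan2 :: "'a graph \<Rightarrow> 'a \<Rightarrow> nat" where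
  "jordan2 t v = Min ((\<lambda>u. jordan t v * max (jordan t u) (jordan t v)) ` jordan_minimizers t v)"

(* Rank functions on the vertices with ranks 1, ..., card (verts t), rank 1 going to the
   largest value; undefined outside verts t, so that there are only finitely many. *)
definition decreasing_rankings :: "'a graph \<Rightarrow> ('a \<Rightarrow> nat) \<Rightarrow> ('a \<Rightarrow> nat) set" where
  "decreasing_rankings t f =
     {\<sigma> \<in> extensional (verts t). bij_betw \<sigma> (verts t) {1..card (verts t)} \<and>
        (\<forall>u\<in>verts t. \<forall>v\<in>verts t. f u > f v \<longrightarrow> \<sigma> u < \<sigma> v)}"

(* Uniform tie-breaking: all rankings compatible with the values are equally likely. *)
definition jordan2_ordering :: "'a graph \<Rightarrow> ('a \<Rightarrow> nat) pmf" where
  "jordan2_ordering t = pmf_of_set (decreasing_rankings t (jordan2 t))"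

(* The law of the uniform random recursive tree on {1..n}; n = 0 is a dummy case. *)
fun random_recursive_tree :: "nat \<Rightarrow> nat graph pmf" where
  "random_recursive_tree 0 = return_pmf (Graph {} {})"
| "random_recursive_tree (Suc 0) = return_pmf (Graph {1} {})"
| "random_recursive_tree (Suc (Suc m)) =
     do {
       t \<leftarrow> random_recursive_tree (Suc m);
       u \<leftarrow> pmf_of_set {1..Suc m};
       return_pmf (Graph (insert (Suc (Suc m)) (verts t)) (insert {u, Suc (Suc m)} (edges t)))
     }"

definition ordered_random_recursive_tree :: "nat \<Rightarrow> (nat graph \<times> (nat \<Rightarrow> nat)) pmf" where
  "ordered_random_recursive_tree n =
     do {
       t \<leftarrow> random_recursive_tree n;
       \<sigma> \<leftarrow> jordan2_ordering t;
       return_pmf (t, \<sigma>)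
     }"

definition top_ranked :: "'a graph \<Rightarrow> ('a \<Rightarrow> nat) \<Rightarrow> int \<Rightarrow> 'a set" where
  "top_ranked t \<sigma> k = {u \<in> verts t. int (\<sigma> u) \<le> k}"

end

theory Submission
  imports Defs
begin

text \<open>
  Root the tree at vertex 1 and let \<open>S v\<close> be the number of descendants of \<open>v\<close>, including \<open>v\<close>. Looking
  at a vertex \<open>v \<noteq> 1\<close> from its parent shows that the Jordan centrality of \<open>v\<close> is at most \<open>S v\<close>, and
  since the minimizing neighbour is the parent \<open>p\<close> of \<open>v\<close> or a child of \<open>v\<close>, the Jordan-2 centrality
  of \<open>v\<close> is at most \<open>S v * S p\<close> (\<open>jordan2_le_link\<close>). So vertex 1 can only be beaten by the children in heavy
  links, the edges for which this product is at least the value of vertex 1. With \<open>X = x * n\<^sup>2\<close> two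
  estimates remain.

  \<^item> The value of vertex 1 is at least \<open>X\<close> except with probability of order \<open>x * ln (1 / x)\<close>
    (\<open>prob_jordan2_root_small\<close>). A smaller value forces a branch of the root, or a branch together with
    a branch of this branch, to contain nearly all vertices, and the expected number of such
    configurations is small. Near 0, the value divided by \<open>n\<^sup>2\<close> behaves like a product of two
    independent uniform variables.

  \<^item> The number of heavy links is at most of order \<open>1 / sqrt x\<close> except with probability of order \<open>x\<close>
    (\<open>prob_many_heavy_links\<close>). This follows from a bound on an exponential moment.

  For \<open>x\<close> of order \<open>\<epsilon> / ln (1 / \<epsilon>)\<close> the first error is of order \<open>\<epsilon>\<close> and the rank of vertex 1 is at
  most of order \<open>sqrt (ln (1 / \<epsilon>) / \<epsilon>)\<close>, as required.

  Both estimates rest on the recursive structure of the tree: the subtree of vertex 2 has uniform size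
  \<open>u\<close> on \<open>{1..n-1}\<close>, and given \<open>u\<close>, this subtree and the rest are independent recursive trees with \<open>u\<close>
  and \<open>n - u\<close> vertices (\<open>avg_grow_sum\<close>). Expectations therefore satisfy a recursion, which gives
  the expected branch sizes at the root exactly (\<open>avg_kids\<close>) and allows the exponential moment to be
  bounded by induction (\<open>heavy_mgf_small\<close>, \<open>heavy_mgf_large\<close>). The induction carries two sizes, that of
  the remaining piece and that of the full subtree of its root, because a child is compared with all
  descendants of its parent and not only with those in the remaining piece.

  Finally, for \<open>\<epsilon>\<close> near 1 the set has a single element, so vertex 1 must have rank 1 with a probability
  bounded away from 0 uniformly in \<open>n\<close> (\<open>prob_root_first_bound\<close>).
\<close>

section \<open>Rooted trees and the subtrees cut off by an edge\<close>

text \<open>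
  In \<open>Join c t\<close> the root of \<open>t\<close> is the root, and the root of \<open>c\<close> is its oldest child. This binary encoding of ordered rooted trees has one leaf
  \<open>Single v\<close> per vertex, and \<open>Join\<close> is exactly the splitting that drives the probabilistic part.
\<close>

datatype 'a rtree = Single 'a | Join "'a rtree" "'a rtree"

fun root_of :: "'a rtree \<Rightarrow> 'a" where
  "root_of (Single v) = v"
| "root_of (Join c t) = root_of t"

fun vcount :: "'a rtree \<Rightarrow> nat" where
  "vcount (Single v) = 1"
| "vcount (Join c t) = vcount c + vcount t"

text \<open>
  The subtrees hanging from the root, oldest first.
\<close>

fun kids :: "'a rtree \<Rightarrow> 'a rtree list" where
  "kids (Single v) = []"
| "kids (Join c t) = c # kids t"

fun tree_edges :: "'a rtree \<Rightarrow> 'a set set" where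
  "tree_edges (Single v) = {}"
| "tree_edges (Join c t) = insert {root_of c, root_of t} (tree_edges c \<union> tree_edges t)"

definition graph_of :: "'a rtree \<Rightarrow> 'a graph" where
  "graph_of T = Graph (set_rtree T) (tree_edges T)"

fun distinct_verts :: "'a rtree \<Rightarrow> bool" where
  "distinct_verts (Single v) = True"
| "distinct_verts (Join c t) \<longleftrightarrow>
     distinct_verts c \<and> distinct_verts t \<and> set_rtree c \<inter> set_rtree t = {}"

text \<open>
  The pairs (full subtree of the parent, full subtree of the child) for the edges of a tree; the
  parameter \<open>P\<close> is the full subtree of the root, of which the second argument is the part still to be
  traversed. Thus \<open>links T T\<close> lists the edges of \<open>T\<close> together with the subtree sizes at both ends.
\<close>

fun links :: "'a rtree \<Rightarrow> 'a rtree \<Rightarrow> ('a rtree \<times> 'a rtree) set" where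
  "links P (Single v) = {}"
| "links P (Join c t) = insert (P, c) (links c c \<union> links P t)"

lemma root_in_verts [simp]: "root_of T \<in> set_rtree T"
  by (induction T) auto

lemma vcount_pos [simp]: "vcount T > 0"
  by (induction T) auto

lemma finite_verts [simp]: "finite (set_rtree T)"
  by (induction T) auto

lemma card_verts: "distinct_verts T \<Longrightarrow> card (set_rtree T) = vcount T"
  by (induction T) (auto simp: card_Un_disjoint)

lemma verts_graph_of [simp]: "verts (graph_of T) = set_rtree T"
  and edges_graph_of [simp]: "edges (graph_of T) = tree_edges T"
  by (simp_all add: graph_of_def)

lemma is_path_mono:
  assumes "is_path g u p w" "verts g \<subseteq> verts h" "edges g \<subseteq> edges h"
  shows "is_path h u p w"
  using assms unfolding is_path_def by (auto elim: successively_mono)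

lemma is_path_append:
  assumes "is_path g u p v" "is_path g v' q w" "{v, v'} \<in> edges g" "set p \<inter> set q = {}"
  shows "is_path g u (p @ q) w"
  using assms unfolding is_path_def by (auto simp: successively_append_iff)

lemma is_path_rtree:
  assumes "distinct_verts T" "u \<in> set_rtree T" "w \<in> set_rtree T"
  shows "\<exists>p. is_path (graph_of T) u p w"
  using assms
proof (induction T arbitrary: u w)
  case (Single v)
  then have "is_path (graph_of (Single v)) u [v] w" by (simp add: is_path_def)
  then show ?case by blast
next
  case (Join c t)
  let ?g = "graph_of (Join c t)"
  have c: "\<exists>p. is_path ?g x p y \<and> set p \<subseteq> set_rtree c"
    if xy: "x \<in> set_rtree c" "y \<in> set_rtree c" for x y
  proof -
    obtain p where "is_path (graph_of c) x p y" using Join.IH(1)[OF _ xy] Join.prems(1) by auto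
    then have "is_path ?g x p y" "set p \<subseteq> set_rtree c"
      by (auto elim!: is_path_mono) (auto simp: is_path_def)
    then show ?thesis by blast
  qed
  have t: "\<exists>p. is_path ?g x p y \<and> set p \<subseteq> set_rtree t"
    if xy: "x \<in> set_rtree t" "y \<in> set_rtree t" for x y
  proof -
    obtain p where "is_path (graph_of t) x p y" using Join.IH(2)[OF _ xy] Join.prems(1) by auto
    then have "is_path ?g x p y" "set p \<subseteq> set_rtree t"
      by (auto elim!: is_path_mono) (auto simp: is_path_def)
    then show ?thesis by blast
  qed
  have disj: "set_rtree c \<inter> set_rtree t = {}" using Join.prems by simp
  consider "u \<in> set_rtree c" "w \<in> set_rtree c" | "u \<in> set_rtree t" "w \<in> set_rtree t"
    | "u \<in> set_rtree c" "w \<in> set_rtree t" | "u \<in> set_rtree t" "w \<in> set_rtree c"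
    using Join.prems by auto
  then show ?case
  proof cases
    case 1 then show ?thesis using c by blast
  next
    case 2 then show ?thesis using t by blast
  next
    case 3
    obtain p q where pq: "is_path ?g u p (root_of c)" "set p \<subseteq> set_rtree c"
      "is_path ?g (root_of t) q w" "set q \<subseteq> set_rtree t"
      using c[OF 3(1) root_in_verts] t[OF root_in_verts 3(2)] by blast
    then have "is_path ?g u (p @ q) w" using disj by (intro is_path_append[OF pq(1) pq(3)]) auto
    then show ?thesis by blast
  next
    case 4
    obtain p q where pq: "is_path ?g u p (root_of t)" "set p \<subseteq> set_rtree t"
      "is_path ?g (root_of c) q w" "set q \<subseteq> set_rtree c"
      using t[OF 4(1) root_in_verts] c[OF root_in_verts 4(2)] by blast
    then have "is_path ?g u (p @ q) w" using disj
      by (intro is_path_append[OF pq(1) pq(3)]) (auto simp: insert_commute)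
    then show ?thesis by blast
  qed
qed

lemma successively_crossing:
  assumes "successively R (x # ys)" "x \<in> A" "last (x # ys) \<in> B" "A \<inter> B = {}"
    "set (x # ys) \<subseteq> A \<union> B"
  shows "\<exists>a\<in>A. \<exists>b\<in>B. b \<in> set ys \<and> R a b"
  using assms
proof (induction ys arbitrary: x)
  case Nil then show ?case by auto
next
  case (Cons y ys)
  show ?case
  proof (cases "y \<in> B")
    case True then show ?thesis using Cons.prems by auto
  next
    case False
    then have "y \<in> A" using Cons.prems by auto
    then have "\<exists>a\<in>A. \<exists>b\<in>B. b \<in> set ys \<and> R a b" using Cons.prems by (intro Cons.IH[of y]) auto
    then show ?thesis by auto
  qed
qed

lemma tree_edges_subset: "\<Union>(tree_edges T) \<subseteq> set_rtree T"
  by (induction T) auto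

text \<open>
  A path that leaves \<open>p\<close>, visits \<open>c\<close> and ends on the side of \<open>p\<close> has to cross the only edge between
  the two sides a second time, hence to return to its starting point. So the vertices reached from
  \<open>p\<close> through \<open>c\<close> are exactly those on the side of \<open>c\<close>.
\<close>

lemma subtree_bridge:
  assumes A: "set_rtree A \<inter> set_rtree B = {}" "distinct_verts A"
    and c: "c \<in> set_rtree A" "p \<in> set_rtree B"
    and V: "verts g = set_rtree A \<union> set_rtree B"
    and E: "edges g = insert {c, p} (tree_edges A \<union> tree_edges B)"
  shows "subtree g p c = set_rtree A"
proof (intro equalityI subsetI)
  fix w assume w: "w \<in> set_rtree A"
  obtain q where q: "is_path (graph_of A) c q w" using is_path_rtree[OF A(2) c(1) w] by blast
  then have "is_path g c q w" "set q \<subseteq> set_rtree A"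
    using V E by (auto elim!: is_path_mono simp del: insert_subset) (auto simp: is_path_def)
  moreover have "is_path g p [p] p" using c V by (simp add: is_path_def)
  ultimately have "is_path g p ([p] @ q) w"
    using A c E by (intro is_path_append) (auto simp: insert_commute)
  moreover have "c \<in> set q" using q by (auto simp: is_path_def)
  ultimately show "w \<in> subtree g p c" using w V by (auto simp: subtree_def)
next
  fix w assume "w \<in> subtree g p c"
  then obtain q where q: "is_path g p q w" "c \<in> set q" and w: "w \<in> verts g"
    by (auto simp: subtree_def)
  show "w \<in> set_rtree A"
  proof (rule ccontr)
    assume nw: "w \<notin> set_rtree A"
    obtain xs ys where s: "q = xs @ c # ys" using q(2) by (meson split_list)
    have "c \<noteq> p" using A c by auto
    then have xs: "p \<in> set xs" using q(1) s by (cases xs) (auto simp: is_path_def)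
    have "successively (\<lambda>x y. {x, y} \<in> edges g) (c # ys)"
      using q(1) s by (auto simp: is_path_def successively_append_iff)
    moreover have "last (c # ys) = w" "set (c # ys) \<subseteq> set_rtree A \<union> set_rtree B"
      using q(1) s V by (auto simp: is_path_def)
    ultimately obtain a b where ab: "a \<in> set_rtree A" "b \<in> set_rtree B" "b \<in> set ys" "{a, b} \<in> edges g"
      using successively_crossing[of "\<lambda>x y. {x, y} \<in> edges g" c ys "set_rtree A" "set_rtree B"] A c w nw V
      by fastforce
    have "{a, b} \<notin> tree_edges A" "{a, b} \<notin> tree_edges B"
      using ab A(1) tree_edges_subset[of A] tree_edges_subset[of B] by auto
    then have "{a, b} = {c, p}" using ab(4) E by simp
    moreover have "b \<noteq> c" using ab A c by auto
    ultimately have "b = p" by (auto simp: doubleton_eq_iff)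
    then show False using ab xs q(1) s by (auto simp: is_path_def)
  qed
qed

text \<open>
  Pruning the branch \<open>c\<close> leaves a tree again, so that both sides of a link are connected and
  \<open>subtree_bridge\<close> applies in both directions.
\<close>

lemma links_split:
  assumes "(P, c) \<in> links Q T" "root_of Q = root_of T" "distinct_verts T"
  shows "\<exists>R. distinct_verts c \<and> distinct_verts R \<and> set_rtree c \<inter> set_rtree R = {} \<and>
    set_rtree T = set_rtree c \<union> set_rtree R \<and> root_of P \<in> set_rtree R \<and> root_of R = root_of T \<and>
    tree_edges T = insert {root_of c, root_of P} (tree_edges c \<union> tree_edges R)"
  using assms
proof (induction T arbitrary: Q)
  case (Single v) then show ?case by simp
next
  case (Join a b)
  consider "P = Q" "c = a" | "(P, c) \<in> links a a" | "(P, c) \<in> links Q b" using Join.prems by auto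
  then show ?case
  proof cases
    case 1
    then show ?thesis using Join.prems by (intro exI[of _ b]) auto
  next
    case 2
    obtain R where R: "distinct_verts c" "distinct_verts R" "set_rtree c \<inter> set_rtree R = {}"
      "set_rtree a = set_rtree c \<union> set_rtree R" "root_of P \<in> set_rtree R" "root_of R = root_of a"
      "tree_edges a = insert {root_of c, root_of P} (tree_edges c \<union> tree_edges R)"
      using Join.IH(1)[OF 2] Join.prems by auto
    show ?thesis using R Join.prems by (intro exI[of _ "Join R b"]) auto
  next
    case 3
    obtain R where R: "distinct_verts c" "distinct_verts R" "set_rtree c \<inter> set_rtree R = {}"
      "set_rtree b = set_rtree c \<union> set_rtree R" "root_of P \<in> set_rtree R" "root_of R = root_of b"
      "tree_edges b = insert {root_of c, root_of P} (tree_edges c \<union> tree_edges R)"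
      using Join.IH(2)[OF 3] Join.prems by auto
    show ?thesis using R Join.prems by (intro exI[of _ "Join a R"]) auto
  qed
qed

lemma links_facts:
  assumes "(P, c) \<in> links T T" "distinct_verts T"
  shows "subtree (graph_of T) (root_of P) (root_of c) = set_rtree c"
    and "subtree (graph_of T) (root_of c) (root_of P) = set_rtree T - set_rtree c"
    and "root_of P \<in> neighbors (graph_of T) (root_of c)" "root_of c \<in> neighbors (graph_of T) (root_of P)"
    and "distinct_verts c" "set_rtree c \<subseteq> set_rtree T" "root_of c \<noteq> root_of T"
proof -
  obtain R where R: "distinct_verts c" "distinct_verts R" "set_rtree c \<inter> set_rtree R = {}"
      "set_rtree T = set_rtree c \<union> set_rtree R" "root_of P \<in> set_rtree R" "root_of R = root_of T"
      "tree_edges T = insert {root_of c, root_of P} (tree_edges c \<union> tree_edges R)"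
    using links_split[OF assms(1)] assms(2) by blast
  show "subtree (graph_of T) (root_of P) (root_of c) = set_rtree c"
    using R by (intro subtree_bridge[of c R]) auto
  have "subtree (graph_of T) (root_of c) (root_of P) = set_rtree R"
    using R by (intro subtree_bridge[of R c]) (auto simp: insert_commute)
  then show "subtree (graph_of T) (root_of c) (root_of P) = set_rtree T - set_rtree c" using R by auto
  show "root_of P \<in> neighbors (graph_of T) (root_of c)" "root_of c \<in> neighbors (graph_of T) (root_of P)"
    using R by (auto simp: neighbors_def insert_commute)
  show "distinct_verts c" "set_rtree c \<subseteq> set_rtree T" "root_of c \<noteq> root_of T"
    using R root_in_verts[of c] root_in_verts[of R] by (auto simp del: root_in_verts)
qed

lemma tree_edges_links:
  assumes "e \<in> tree_edges T" "root_of Q = root_of T"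
  shows "\<exists>P c. (P, c) \<in> links Q T \<and> e = {root_of P, root_of c}"
  using assms
proof (induction T arbitrary: Q)
  case (Single v) then show ?case by simp
next
  case (Join a b)
  consider "e = {root_of a, root_of b}" | "e \<in> tree_edges a" | "e \<in> tree_edges b"
    using Join.prems by auto
  then show ?case
  proof cases
    case 1
    then have "(Q, a) \<in> links Q (Join a b) \<and> e = {root_of Q, root_of a}"
      using Join.prems by auto
    then show ?thesis by blast
  next
    case 2 then show ?thesis using Join.IH(1)[of a] by auto
  next
    case 3 then show ?thesis using Join.IH(2)[of Q] Join.prems by auto
  qed
qed

lemma neighbors_links:
  assumes "u \<in> neighbors (graph_of T) v"
  obtains P c where "(P, c) \<in> links T T" "root_of P = u \<and> root_of c = v \<or> root_of P = v \<and> root_of c = u"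
proof -
  have "{u, v} \<in> tree_edges T" using assms by (simp add: neighbors_def insert_commute)
  then obtain P c where "(P, c) \<in> links T T" "{u, v} = {root_of P, root_of c}"
    using tree_edges_links[of "{u, v}" T T] by blast
  then show ?thesis using that by (auto simp: doubleton_eq_iff)
qed

lemma links_parent:
  assumes "(P, c) \<in> links Q T"
  shows "(P = Q \<and> c \<in> set (kids T)) \<or> ((\<exists>P'. (P', P) \<in> links Q T) \<and> c \<in> set (kids P))"
  using assms by (induction T arbitrary: Q) fastforce+

lemma kids_links: "c \<in> set (kids T) \<Longrightarrow> (Q, c) \<in> links Q T"
  by (induction T) auto

lemma kids_vcount: "c \<in> set (kids T) \<Longrightarrow> vcount c < vcount T"
  by (induction T) (auto simp: add_strict_increasing trans_less_add1 trans_less_add2)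

lemma links_kids: "(P, c) \<in> links T T \<Longrightarrow> c \<in> set (kids P)"
  using links_parent[of P c T T] by auto

lemma links_vcount_le: "(P, c) \<in> links Q T \<Longrightarrow> vcount c < vcount T"
  by (induction T arbitrary: Q) (fastforce simp: trans_less_add1 trans_less_add2)+

lemma links_verts: "(P, c) \<in> links Q T \<Longrightarrow> set_rtree c \<subseteq> set_rtree T"
  by (induction T arbitrary: Q) fastforce+

lemma links_root_neq:
  assumes "(P, c) \<in> links Q T" "distinct_verts T"
  shows "root_of c \<noteq> root_of T"
  using assms
proof (induction T arbitrary: Q)
  case (Join a b)
  have "set_rtree a \<inter> set_rtree b = {}" using Join.prems by simp
  then have "root_of a \<notin> set_rtree b" using root_in_verts[of a] by blast
  then show ?case
    using Join links_verts[of P c a a] root_in_verts[of c] root_in_verts[of b] by fastforce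
qed simp

lemma links_unique:
  assumes "(P, c) \<in> links Q T" "(P', c') \<in> links Q T" "root_of c = root_of c'" "distinct_verts T"
  shows "P = P' \<and> c = c'"
  using assms
proof (induction T arbitrary: Q)
  case (Single v) then show ?case by simp
next
  case (Join a b)
  have disj: "set_rtree a \<inter> set_rtree b = {}" using Join.prems by simp
  then have ra: "root_of a \<notin> set_rtree b" using root_in_verts[of a] by blast
  have a: "root_of d \<in> set_rtree a" "root_of d \<noteq> root_of a" if "(X, d) \<in> links a a" for X d
    using links_verts[OF that] links_root_neq[OF that] Join.prems root_in_verts[of d] by auto
  have b: "root_of d \<in> set_rtree b" if "(X, d) \<in> links Q b" for X d
    using links_verts[OF that] root_in_verts[of d] by auto
  consider "(P, c) = (Q, a)" | "(P, c) \<in> links a a" | "(P, c) \<in> links Q b" using Join.prems by auto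
  then show ?case
  proof cases
    case 1
    then have "(P', c') \<notin> links a a" "(P', c') \<notin> links Q b"
      using a(2)[of P' c'] b[of P' c'] Join.prems(3) disj root_in_verts[of a] by auto
    then show ?thesis using 1 Join.prems(2) by auto
  next
    case 2
    then have "(P', c') \<noteq> (Q, a)" "(P', c') \<notin> links Q b"
      using a[OF 2] b[of P' c'] Join.prems(3) disj by auto
    then show ?thesis using 2 Join.IH(1)[of a] Join.prems by auto
  next
    case 3
    then have "(P', c') \<noteq> (Q, a)" "(P', c') \<notin> links a a"
      using a(1)[of P' c'] b[OF 3] Join.prems(3) disj ra by auto
    then show ?thesis using 3 Join.IH(2)[of Q] Join.prems by auto
  qed
qed

section \<open>Jordan-2 centrality in terms of subtree sizes\<close>

lemma jordan_le:
  assumes "u \<in> neighbors t v" "finite (verts t)"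
  shows "jordan t v \<le> card (subtree t u v)"
  using assms unfolding jordan_def neighbors_def by (intro Min_le) auto

lemma jordan_attained:
  assumes "neighbors t v \<noteq> {}" "finite (verts t)"
  obtains u where "u \<in> neighbors t v" "jordan t v = card (subtree t u v)"
proof -
  have "finite (neighbors t v)" using assms by (simp add: neighbors_def)
  then have "jordan t v \<in> (\<lambda>u. card (subtree t u v)) ` neighbors t v"
    unfolding jordan_def using assms by (intro Min_in) auto
  then show ?thesis using that by auto
qed

lemma jordan2_attained:
  assumes "neighbors t v \<noteq> {}" "finite (verts t)"
  obtains u where "u \<in> neighbors t v" "jordan t v = card (subtree t u v)"
    "jordan2 t v = jordan t v * max (jordan t u) (jordan t v)"
proof -
  have fin: "finite (jordan_minimizers t v)"
    using assms by (simp add: neighbors_def jordan_minimizers_def)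
  have "jordan_minimizers t v \<noteq> {}"
    using jordan_attained[OF assms] unfolding jordan_minimizers_def
    by (metis (mono_tags, lifting) empty_Collect_eq)
  then have "jordan2 t v \<in> (\<lambda>u. jordan t v * max (jordan t u) (jordan t v)) ` jordan_minimizers t v"
    unfolding jordan2_def using fin by (intro Min_in) auto
  then show ?thesis using that by (auto simp: jordan_minimizers_def)
qed

lemma non_root_links:
  assumes "v \<in> set_rtree T" "v \<noteq> root_of T"
  shows "\<exists>P c. (P, c) \<in> links Q T \<and> root_of c = v"
  using assms
proof (induction T arbitrary: Q)
  case (Join a b)
  then show ?case by (cases "v = root_of a") fastforce+
qed simp

context
  fixes T :: "'a rtree"
  assumes dv: "distinct_verts T"
begin

text \<open>
  The parent is one of the neighbours over which the minimum is taken.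
\<close>

lemma jordan_child_le:
  assumes "(P, c) \<in> links T T"
  shows "jordan (graph_of T) (root_of c) \<le> vcount c"
proof -
  have "jordan (graph_of T) (root_of c) \<le> card (set_rtree c)"
    using jordan_le[of "root_of P" "graph_of T" "root_of c"] links_facts[OF assms dv] by simp
  then show ?thesis using card_verts links_facts(5)[OF assms dv] by metis
qed

lemma card_verts_diff:
  assumes "(P, c) \<in> links T T"
  shows "card (set_rtree T - set_rtree c) = vcount T - vcount c"
  using links_facts(5,6)[OF assms dv] dv by (simp add: card_Diff_subset card_verts)

lemma links_order:
  assumes "(P, c) \<in> links T T"
  shows "vcount c < vcount P" "P = T \<or> vcount P < vcount T"
  using kids_vcount[OF links_kids[OF assms]] links_parent[OF assms] links_vcount_le by blast+

lemma jordan_parent_le: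
  assumes "(P, c) \<in> links T T"
  shows "jordan (graph_of T) (root_of P) \<le> min (vcount P) (vcount T - 1)"
proof (cases "P = T")
  case True
  have "jordan (graph_of T) (root_of P) \<le> vcount T - vcount c"
    using jordan_le[of "root_of c" "graph_of T" "root_of P"] links_facts[OF assms dv]
      card_verts_diff[OF assms] by simp
  also have "\<dots> \<le> vcount T - 1" by (intro diff_le_mono2) (simp add: Suc_leI)
  finally show ?thesis using True by simp
next
  case False
  then obtain P' where P': "(P', P) \<in> links T T" using links_parent[OF assms] by blast
  show ?thesis using jordan_child_le[OF P'] links_order(2)[OF assms] False by simp
qed

text \<open>
  The minimizing neighbour \<open>u\<close> of \<open>v\<close> is its parent or a child. In the first case the link above \<open>v\<close>
  gives the bound directly; in the second \<open>u\<close> has even fewer descendants than \<open>v\<close>, so the link above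
  \<open>v\<close> works again. The minimum with the number of vertices minus one serves the tree with two vertices, where the
  root merely ties with its child.
\<close>

lemma jordan2_le_link:
  assumes "v \<in> set_rtree T" "v \<noteq> root_of T"
  obtains P c where "(P, c) \<in> links T T" "root_of c = v"
    "jordan2 (graph_of T) v \<le> vcount c * min (vcount P) (vcount T - 1)"
proof -
  let ?J = "jordan (graph_of T)"
  obtain P0 c0 where P0: "(P0, c0) \<in> links T T" "root_of c0 = v"
    using non_root_links[OF assms] by blast
  have ne: "neighbors (graph_of T) v \<noteq> {}" using links_facts(3)[OF P0(1) dv] P0(2) by auto
  obtain u where u: "u \<in> neighbors (graph_of T) v"
    and j2: "jordan2 (graph_of T) v = ?J v * max (?J u) (?J v)"
    using jordan2_attained[OF ne] by (metis finite_verts verts_graph_of)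
  obtain P c where Pc: "(P, c) \<in> links T T"
    and "root_of P = u \<and> root_of c = v \<or> root_of P = v \<and> root_of c = u"
    using neighbors_links[OF u] by blast
  then consider "root_of P = u" "root_of c = v" | "root_of P = v" "root_of c = u" by blast
  then show ?thesis
  proof cases
    case 1
    have "?J v \<le> vcount c" "?J u \<le> min (vcount P) (vcount T - 1)"
      using jordan_child_le[OF Pc] jordan_parent_le[OF Pc] 1 by auto
    moreover have "vcount c \<le> min (vcount P) (vcount T - 1)"
      using links_order[OF Pc] by auto
    ultimately have "jordan2 (graph_of T) v \<le> vcount c * min (vcount P) (vcount T - 1)"
      unfolding j2 by (intro mult_mono) auto
    then show ?thesis using that Pc 1 by blast
  next
    case 2
    then have "P \<noteq> T" using assms by auto
    then obtain P' where P': "(P', P) \<in> links T T" using links_parent[OF Pc] by blast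
    have "?J v \<le> vcount P" "?J u \<le> vcount P"
      using jordan_child_le[OF Pc] jordan_child_le[OF P'] links_order(1)[OF Pc] 2 by auto
    moreover have "vcount P \<le> min (vcount P') (vcount T - 1)"
      using links_order[OF P'] by auto
    ultimately have "jordan2 (graph_of T) v \<le> vcount P * min (vcount P') (vcount T - 1)"
      unfolding j2 by (intro mult_mono) auto
    then show ?thesis using that P' 2 by blast
  qed
qed

text \<open>
  With \<open>n\<close> vertices, the Jordan centrality of the root is \<open>n - |a|\<close> for a largest branch \<open>a\<close>, and that
  of the root of \<open>a\<close> is either \<open>|a|\<close>, seen from its parent, or \<open>n - |b|\<close> for a branch \<open>b\<close> of \<open>a\<close>. The
  Jordan-2 centrality of the root is the product of the first with the maximum of the two.
\<close>

lemma jordan2_root: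
  assumes "vcount T \<ge> 2"
  obtains a where "a \<in> set (kids T)"
    "(vcount T - vcount a)\<^sup>2 \<le> jordan2 (graph_of T) (root_of T)"
    "(vcount T - vcount a) * vcount a \<le> jordan2 (graph_of T) (root_of T) \<or>
     (\<exists>b \<in> set (kids a). (vcount T - vcount a) * (vcount T - vcount b) \<le> jordan2 (graph_of T) (root_of T))"
proof -
  let ?J = "jordan (graph_of T)" and ?g = "graph_of T"
  obtain a0 where "a0 \<in> set (kids T)" using assms by (cases T) auto
  then have ne: "neighbors ?g (root_of T) \<noteq> {}" using links_facts(4)[OF kids_links dv] by blast
  obtain w where w: "w \<in> neighbors ?g (root_of T)" "?J (root_of T) = card (subtree ?g w (root_of T))"
    "jordan2 ?g (root_of T) = ?J (root_of T) * max (?J w) (?J (root_of T))"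
    using jordan2_attained[OF ne] by (metis finite_verts verts_graph_of)
  obtain P a where Pa: "(P, a) \<in> links T T" "root_of P = root_of T" "root_of a = w"
    using neighbors_links[OF w(1)] links_facts(7)[OF _ dv] by metis
  have P: "P = T"
    using links_parent[OF Pa(1)] links_facts(7)[OF _ dv] Pa(2) by metis
  then have a: "a \<in> set (kids T)" using links_kids[OF Pa(1)] by simp
  have Jr: "?J (root_of T) = vcount T - vcount a"
    using w(2) links_facts(2)[OF Pa(1) dv] Pa card_verts_diff[OF Pa(1)] by simp
  have ne': "neighbors ?g w \<noteq> {}" using links_facts(3)[OF Pa(1) dv] Pa by auto
  obtain u where u: "u \<in> neighbors ?g w" "?J w = card (subtree ?g u w)"
    using jordan_attained[OF ne'] by (metis finite_verts verts_graph_of)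
  obtain P' c where P'c: "(P', c) \<in> links T T"
    and "root_of P' = u \<and> root_of c = w \<or> root_of P' = w \<and> root_of c = u"
    using neighbors_links[OF u(1)] by blast
  then consider "root_of P' = u" "root_of c = w" | "root_of P' = w" "root_of c = u" by blast
  then have "?J w = vcount a \<or> (\<exists>b \<in> set (kids a). ?J w = vcount T - vcount b)"
  proof cases
    case 1
    then have "c = a" using links_unique[OF P'c Pa(1)] Pa dv by simp
    then show ?thesis
      using u(2) links_facts(1,5)[OF P'c dv] 1 card_verts by metis
  next
    case 2
    then have "P' \<noteq> T" using links_facts(7)[OF Pa(1) dv] Pa by auto
    then obtain P'' where "(P'', P') \<in> links T T" using links_parent[OF P'c] by blast
    then have "P' = a" using links_unique[OF _ Pa(1)] Pa 2 dv by simp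
    then have "c \<in> set (kids a)" using links_kids[OF P'c] by simp
    moreover have "?J w = vcount T - vcount c"
      using u(2) links_facts(2)[OF P'c dv] 2 card_verts_diff[OF P'c] by simp
    ultimately show ?thesis by blast
  qed
  moreover have "?J (root_of T) * ?J w \<le> jordan2 ?g (root_of T)"
    unfolding w(3) by (intro mult_le_mono2) simp
  ultimately have "(vcount T - vcount a) * vcount a \<le> jordan2 ?g (root_of T) \<or>
     (\<exists>b \<in> set (kids a). (vcount T - vcount a) * (vcount T - vcount b) \<le> jordan2 ?g (root_of T))"
    unfolding Jr by metis
  moreover have "(vcount T - vcount a)\<^sup>2 \<le> jordan2 ?g (root_of T)"
    unfolding w(3) Jr power2_eq_square by (intro mult_le_mono2) simp
  ultimately show ?thesis using that[OF a] by blast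
qed

end

text \<open>
  The number of links whose two subtree sizes have product at least \<open>X\<close>. The parameter \<open>s\<close> is the
  size of the full subtree of the root: while older children are split off, younger ones are still
  compared with the size that their parent had at the start.
\<close>

fun heavy_links :: "real \<Rightarrow> nat \<Rightarrow> 'a rtree \<Rightarrow> nat" where
  "heavy_links X s (Single v) = 0"
| "heavy_links X s (Join c t) =
     of_bool (X \<le> real (vcount c * s)) + heavy_links X (vcount c) c + heavy_links X s t"

lemma card_heavy_links:
  "card {root_of c | P c. (P, c) \<in> links Q T \<and> X \<le> real (vcount c * vcount P)} \<le>
     heavy_links X (vcount Q) T"
proof (induction T arbitrary: Q)
  case (Single v) then show ?case by simp
next
  case (Join a b)
  let ?S = "\<lambda>Q T. {root_of c | P c. (P, c) \<in> links Q T \<and> X \<le> real (vcount c * vcount P)}"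
  let ?A = "if X \<le> real (vcount a * vcount Q) then {root_of a} else {}"
  have "?S Q (Join a b) = ?A \<union> (?S a a \<union> ?S Q b)" by (auto split: if_splits)
  then have "card (?S Q (Join a b)) \<le> card ?A + (card (?S a a) + card (?S Q b))"
    by (metis (no_types, lifting) add_left_mono card_Un_le order_trans)
  also have "\<dots> \<le> heavy_links X (vcount Q) (Join a b)"
    using Join.IH(1)[of a] Join.IH(2)[of Q] by (cases "X \<le> real (vcount a * vcount Q)") simp_all
  finally show ?case .
qed

text \<open>
  The additional one accounts for the root itself.
\<close>

lemma card_jordan2_ge:
  assumes dv: "distinct_verts T" and X: "X \<le> real (jordan2 (graph_of T) (root_of T))"
  shows "card {v \<in> set_rtree T. jordan2 (graph_of T) (root_of T) \<le> jordan2 (graph_of T) v}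
    \<le> Suc (heavy_links X (vcount T) T)"
proof -
  let ?j = "jordan2 (graph_of T)"
  let ?S = "{root_of c | P c. (P, c) \<in> links T T \<and> X \<le> real (vcount c * vcount P)}"
  have sub: "{v \<in> set_rtree T. ?j (root_of T) \<le> ?j v} \<subseteq> insert (root_of T) ?S"
  proof
    fix v assume v: "v \<in> {v \<in> set_rtree T. ?j (root_of T) \<le> ?j v}"
    show "v \<in> insert (root_of T) ?S"
    proof (cases "v = root_of T")
      case False
      then obtain P c where Pc: "(P, c) \<in> links T T" "root_of c = v"
        "?j v \<le> vcount c * min (vcount P) (vcount T - 1)"
        using jordan2_le_link[OF dv, of v] v by auto
      have "vcount c * min (vcount P) (vcount T - 1) \<le> vcount c * vcount P" by simp
      then have "?j v \<le> vcount c * vcount P" using Pc(3) by linarith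
      then have "real (?j (root_of T)) \<le> real (vcount c * vcount P)"
        using v by (simp only: of_nat_le_iff) auto
      then have "X \<le> real (vcount c * vcount P)" using X by simp
      then show ?thesis using Pc by blast
    qed simp
  qed
  have "?S \<subseteq> set_rtree T" using links_verts by fastforce
  then have fin: "finite ?S" using finite_verts finite_subset by blast
  have "card {v \<in> set_rtree T. ?j (root_of T) \<le> ?j v} \<le> card (insert (root_of T) ?S)"
    using sub fin by (intro card_mono) auto
  also have "\<dots> \<le> Suc (card ?S)" using fin by (simp add: card_insert_if)
  also have "\<dots> \<le> Suc (heavy_links X (vcount T) T)" using card_heavy_links[of T T X] by simp
  finally show ?thesis .
qed

text \<open>
  The subtree of a vertex other than the root lies in a branch and so has at most \<open>M\<close> vertices.
  Once \<open>M * n < (n - M)\<^sup>2\<close> the two bounds put the root strictly above all other vertices.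
\<close>

lemma jordan2_root_max:
  assumes dv: "distinct_verts T" and "vcount T \<ge> 2"
    and M: "\<forall>a \<in> set (kids T). vcount a \<le> M" and v: "v \<in> set_rtree T" "v \<noteq> root_of T"
  shows "jordan2 (graph_of T) v \<le> M * (vcount T - 1)"
    and "(vcount T - M)\<^sup>2 \<le> jordan2 (graph_of T) (root_of T)"
proof -
  obtain P c where Pc: "(P, c) \<in> links T T"
    "jordan2 (graph_of T) v \<le> vcount c * min (vcount P) (vcount T - 1)"
    using jordan2_le_link[OF dv v] by blast
  have "vcount c \<le> M" 
    using Pc(1) M
  proof -
    have "vcount c \<le> M" if "(P, c) \<in> links Q U" "\<forall>a \<in> set (kids U). vcount a \<le> M" for Q U :: "'a rtree"
      using that by (induction U arbitrary: Q) (auto dest: links_vcount_le)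
    then show ?thesis using Pc(1) M by blast
  qed
  then have "vcount c * min (vcount P) (vcount T - 1) \<le> M * (vcount T - 1)"
    by (intro mult_mono) auto
  then show "jordan2 (graph_of T) v \<le> M * (vcount T - 1)" using Pc(2) by simp
next
  obtain a where a: "a \<in> set (kids T)"
    "(vcount T - vcount a)\<^sup>2 \<le> jordan2 (graph_of T) (root_of T)"
    using jordan2_root[OF dv assms(2)] by blast
  have "(vcount T - M)\<^sup>2 \<le> (vcount T - vcount a)\<^sup>2" using M a(1) by (intro power_mono diff_le_mono2) auto
  then show "(vcount T - M)\<^sup>2 \<le> jordan2 (graph_of T) (root_of T)" using a(2) by linarith
qed

section \<open>Rankings and the rank of the root\<close>

text \<open>
  The vertices ranked no later than \<open>r\<close> all have at least the value of \<open>r\<close>, and there are exactly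
  \<open>\<sigma> r\<close> of them.
\<close>

lemma ranking_le_card:
  assumes "\<sigma> \<in> decreasing_rankings t f" "r \<in> verts t" "finite (verts t)"
  shows "\<sigma> r \<le> card {v \<in> verts t. f r \<le> f v}"
proof -
  have b: "bij_betw \<sigma> (verts t) {1..card (verts t)}"
    and m: "\<And>u v. u \<in> verts t \<Longrightarrow> v \<in> verts t \<Longrightarrow> f u > f v \<Longrightarrow> \<sigma> u < \<sigma> v"
    using assms by (auto simp: decreasing_rankings_def)
  have img: "\<sigma> ` verts t = {1..card (verts t)}" using b by (simp add: bij_betw_def)
  have r: "\<sigma> r \<le> card (verts t)" using img assms(2) by auto
  have "{1..\<sigma> r} \<subseteq> \<sigma> ` {v \<in> verts t. f r \<le> f v}"
  proof
    fix i assume i: "i \<in> {1..\<sigma> r}"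
    then have "i \<in> \<sigma> ` verts t" using img r by auto
    then obtain v where v: "v \<in> verts t" "i = \<sigma> v" by blast
    then have "f r \<le> f v" using m[OF assms(2) v(1)] i by (meson atLeastAtMost_iff leD leI)
    then show "i \<in> \<sigma> ` {v \<in> verts t. f r \<le> f v}" using v by blast
  qed
  then have "card {1..\<sigma> r} \<le> card (\<sigma> ` {v \<in> verts t. f r \<le> f v})"
    using assms(3) by (intro card_mono) auto
  also have "\<dots> \<le> card {v \<in> verts t. f r \<le> f v}" using assms(3) by (intro card_image_le) auto
  finally show ?thesis by simp
qed

lemma finite_decreasing_rankings:
  assumes "finite (verts t)"
  shows "finite (decreasing_rankings t f)"
proof (rule finite_subset)
  show "decreasing_rankings t f \<subseteq> verts t \<rightarrow>\<^sub>E {1..card (verts t)}"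
    by (auto simp: decreasing_rankings_def bij_betw_def PiE_def)
  show "finite (verts t \<rightarrow>\<^sub>E {1..card (verts t)})" using assms by (intro finite_PiE) auto
qed

text \<open>
  Rank \<open>r\<close> first and shift a ranking of the remaining vertices by one.
\<close>

lemma exists_ranking:
  fixes f :: "'a \<Rightarrow> nat"
  assumes "finite V" "r \<in> V" "\<forall>v \<in> V. f v \<le> f r"
  shows "\<exists>\<sigma>. bij_betw \<sigma> V {1..card V} \<and> (\<forall>u\<in>V. \<forall>v\<in>V. f u > f v \<longrightarrow> \<sigma> u < \<sigma> v) \<and> \<sigma> r = (1::nat)"
  using assms
proof (induction "card V" arbitrary: V r)
  case 0 then show ?case by auto
next
  case (Suc k)
  let ?W = "V - {r}"
  have W: "k = card ?W" "finite ?W" using Suc by auto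
  have "\<exists>\<tau>. bij_betw \<tau> ?W {1..card ?W} \<and> (\<forall>u\<in>?W. \<forall>v\<in>?W. f u > f v \<longrightarrow> \<tau> u < (\<tau> v :: nat))"
  proof (cases "?W = {}")
    case True show ?thesis unfolding True by (simp add: bij_betw_def)
  next
    case False
    then have "Max (f ` ?W) \<in> f ` ?W" using W by (intro Max_in) auto
    then obtain w where w: "Max (f ` ?W) = f w" "w \<in> ?W" by (rule imageE)
    have "\<forall>v \<in> ?W. f v \<le> f w" unfolding w(1)[symmetric] using W(2) by simp
    with w(2) have "w \<in> ?W" "\<forall>v \<in> ?W. f v \<le> f w" by blast+
    then show ?thesis using Suc.hyps(1)[OF W(1,2)] by blast
  qed
  then obtain \<tau> :: "'a \<Rightarrow> nat" where \<tau>: "bij_betw \<tau> ?W {1..card ?W}"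
    "\<forall>u\<in>?W. \<forall>v\<in>?W. f u > f v \<longrightarrow> \<tau> u < \<tau> v" by blast
  define \<sigma> where "\<sigma> v = (if v = r then 1 else Suc (\<tau> v))" for v
  have "\<sigma> ` ?W = Suc ` (\<tau> ` ?W)" by (force simp: \<sigma>_def)
  also have "\<dots> = {2..card V}"
    using \<tau>(1) Suc.hyps(2) W(1) by (simp add: bij_betw_def image_Suc_atLeastAtMost numeral_2_eq_2)
  finally have iW: "\<sigma> ` ?W = {2..card V}" .
  have "inj_on \<sigma> ?W" using \<tau>(1) by (auto simp: bij_betw_def inj_on_def \<sigma>_def)
  then have b: "bij_betw \<sigma> ?W {2..card V}" using iW by (simp add: bij_betw_def)
  moreover have "bij_betw \<sigma> {r} {1}" by (simp add: \<sigma>_def bij_betw_def)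
  ultimately have "bij_betw \<sigma> (?W \<union> {r}) ({2..card V} \<union> {1})"
    by (rule bij_betw_combine) auto
  moreover have "?W \<union> {r} = V" "{2..card V} \<union> {1} = {1..card V}"
    using Suc by auto
  ultimately have "bij_betw \<sigma> V {1..card V}" by simp
  moreover have "\<sigma> u < \<sigma> v" if uv: "u \<in> V" "v \<in> V" "f u > f v" for u v
  proof -
    have "v \<noteq> r" using uv Suc.prems by force
    then have vW: "v \<in> ?W" using uv by simp
    show ?thesis
    proof (cases "u = r")
      case True
      have "\<sigma> v \<ge> 2" using vW iW by force
      then show ?thesis using True by (simp add: \<sigma>_def)
    next
      case False then show ?thesis using \<tau>(2) uv vW by (auto simp: \<sigma>_def)
    qed
  qed
  ultimately show ?case by (intro exI[of _ \<sigma>]) (auto simp: \<sigma>_def)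
qed

lemma exists_decreasing_ranking:
  assumes "finite (verts t)" "r \<in> verts t" "\<forall>v \<in> verts t. f v \<le> f r"
  shows "\<exists>\<sigma> \<in> decreasing_rankings t f. \<sigma> r = 1"
proof -
  obtain \<sigma> where \<sigma>: "bij_betw \<sigma> (verts t) {1..card (verts t)}"
    "\<forall>u\<in>verts t. \<forall>v\<in>verts t. f u > f v \<longrightarrow> \<sigma> u < \<sigma> v" "\<sigma> r = (1::nat)"
    using exists_ranking[OF assms] by blast
  let ?\<tau> = "restrict \<sigma> (verts t)"
  have "bij_betw ?\<tau> (verts t) {1..card (verts t)}"
    using \<sigma>(1) bij_betw_cong[of "verts t" ?\<tau> \<sigma>] by simp
  then have "?\<tau> \<in> decreasing_rankings t f" "?\<tau> r = 1"
    using \<sigma>(2,3) assms(2) by (simp_all add: decreasing_rankings_def)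
  then show ?thesis by blast
qed

text \<open>
  Only the support is needed below: a bound on the rank that holds for every admissible ranking holds
  for the random one, and a single admissible ranking has positive probability.
\<close>

lemma set_jordan2_ordering:
  assumes "finite (verts t)" "verts t \<noteq> {}"
  shows "set_pmf (jordan2_ordering t) = decreasing_rankings t (jordan2 t)"
proof -
  have "Max (jordan2 t ` verts t) \<in> jordan2 t ` verts t" using assms by (intro Max_in) auto
  then obtain w where "w \<in> verts t" "jordan2 t w = Max (jordan2 t ` verts t)" by auto
  then have "w \<in> verts t" "\<forall>v \<in> verts t. jordan2 t v \<le> jordan2 t w" using assms(1) by auto
  then have "decreasing_rankings t (jordan2 t) \<noteq> {}"
    using exists_decreasing_ranking[OF assms(1)] by blast
  then show ?thesis unfolding jordan2_ordering_def
    using finite_decreasing_rankings[OF assms(1)] by simp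
qed

section \<open>Random recursive trees as random rooted trees\<close>

text \<open>
  The new child is the youngest one, so it is inserted where the leaf of its parent stands. If
  the vertices are distinct, \<open>u\<close> occurs once as such a leaf, so nothing else changes.
\<close>

fun attach :: "'a \<Rightarrow> 'a \<Rightarrow> 'a rtree \<Rightarrow> 'a rtree" where
  "attach u w (Single v) = (if v = u then Join (Single w) (Single v) else Single v)"
| "attach u w (Join c t) = Join (attach u w c) (attach u w t)"

text \<open>
  The growth process of the random recursive tree, with \<open>n = 0\<close> as a dummy case.
\<close>

fun rtree_law :: "nat \<Rightarrow> nat rtree pmf" where
  "rtree_law 0 = return_pmf (Single 1)"
| "rtree_law (Suc 0) = return_pmf (Single 1)"
| "rtree_law (Suc (Suc m)) =
     do {
       T \<leftarrow> rtree_law (Suc m);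
       u \<leftarrow> pmf_of_set {1..Suc m};
       return_pmf (attach u (Suc (Suc m)) T)
     }"

lemma attach_notin: "u \<notin> set_rtree T \<Longrightarrow> attach u w T = T"
  by (induction T) auto

lemma root_attach [simp]: "root_of (attach u w T) = root_of T"
  by (induction T) auto

lemma verts_attach:
  "u \<in> set_rtree T \<Longrightarrow> set_rtree (attach u w T) = insert w (set_rtree T)"
proof (induction T)
  case (Join a b)
  then show ?case
    by (cases "u \<in> set_rtree a"; cases "u \<in> set_rtree b") (auto simp: attach_notin)
qed auto

lemma edges_attach:
  "u \<in> set_rtree T \<Longrightarrow> tree_edges (attach u w T) = insert {u, w} (tree_edges T)"
proof (induction T)
  case (Join a b)
  then show ?case
    by (cases "u \<in> set_rtree a"; cases "u \<in> set_rtree b") (auto simp: attach_notin)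
qed (auto simp: insert_commute)

lemma distinct_attach:
  assumes "distinct_verts T" "w \<notin> set_rtree T"
  shows "distinct_verts (attach u w T)"
  using assms
proof (induction T)
  case (Join a b)
  then show ?case
    by (cases "u \<in> set_rtree a"; cases "u \<in> set_rtree b") (auto simp: attach_notin verts_attach)
qed auto

lemma rtree_law_support:
  assumes "T \<in> set_pmf (rtree_law n)" "n \<ge> 1"
  shows "distinct_verts T" "set_rtree T = {1..n}" "root_of T = 1"
proof -
  have "distinct_verts T \<and> set_rtree T = {1..n} \<and> root_of T = 1"
    using assms
  proof (induction n arbitrary: T rule: rtree_law.induct)
    case (3 m)
    obtain T' u where T': "T' \<in> set_pmf (rtree_law (Suc m))" "u \<in> {1..Suc m}"
      "T = attach u (Suc (Suc m)) T'" using 3(2) by auto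
    have IH: "distinct_verts T'" "set_rtree T' = {1..Suc m}" "root_of T' = 1"
      using "3.IH" T'(1) by auto
    have "set_rtree T = insert (Suc (Suc m)) {1..Suc m}"
      unfolding T'(3) using verts_attach[of u T'] T'(2) IH by simp
    then have V: "set_rtree T = {1..Suc (Suc m)}"
      using atLeastAtMostSuc_conv[of 1 "Suc m"] by simp
    have "distinct_verts T"
      unfolding T'(3) using IH(1,2) by (intro distinct_attach) simp_all
    moreover have "root_of T = 1" unfolding T'(3) using IH(3) by simp
    ultimately show ?case using V by blast
  qed auto
  then show "distinct_verts T" "set_rtree T = {1..n}" "root_of T = 1" by auto
qed

lemma vcount_rtree_law:
  assumes "T \<in> set_pmf (rtree_law n)" "n \<ge> 1"
  shows "vcount T = n"
  using rtree_law_support[OF assms] card_verts[of T] by simp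

lemma finite_rtree_law [simp]: "finite (set_pmf (rtree_law n))"
  by (induction n rule: rtree_law.induct) auto

lemma random_recursive_tree_eq:
  "n \<ge> 1 \<Longrightarrow> random_recursive_tree n = map_pmf graph_of (rtree_law n)"
proof (induction n rule: rtree_law.induct)
  case (3 m)
  have "random_recursive_tree (Suc (Suc m)) = do {
       T \<leftarrow> rtree_law (Suc m);
       u \<leftarrow> pmf_of_set {1..Suc m};
       return_pmf (Graph (insert (Suc (Suc m)) (verts (graph_of T))) (insert {u, Suc (Suc m)} (edges (graph_of T))))
     }"
    using 3 by (simp add: bind_map_pmf)
  also have "\<dots> = do {
       T \<leftarrow> rtree_law (Suc m);
       u \<leftarrow> pmf_of_set {1..Suc m};
       return_pmf (graph_of (attach u (Suc (Suc m)) T))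
     }"
    using rtree_law_support(2)[where n = "Suc m"]
    by (intro bind_pmf_cong refl) (auto simp: graph_of_def verts_attach edges_attach)
  also have "\<dots> = map_pmf graph_of (rtree_law (Suc (Suc m)))"
    by (simp add: map_bind_pmf)
  finally show ?case .
qed (auto simp: graph_of_def)

text \<open>
  Forgetting the ranking maps the law of the ranked tree to the law of the tree, so an event that holds
  for every ranking of each tree in \<open>G\<close> is at least as likely as \<open>G\<close>.
\<close>

lemma prob_ordered_ge:
  assumes "n \<ge> 1"
    and good: "\<And>T \<sigma>. T \<in> set_pmf (rtree_law n) \<Longrightarrow> T \<in> G \<Longrightarrow>
      \<sigma> \<in> decreasing_rankings (graph_of T) (jordan2 (graph_of T)) \<Longrightarrow> real (\<sigma> 1) \<le> k"
  shows "measure_pmf.prob (rtree_law n) G \<le>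
    measure_pmf.prob (ordered_random_recursive_tree n) {(t, \<sigma>). 1 \<in> top_ranked t \<sigma> \<lceil>k\<rceil>}"
proof -
  define D where "D = do { T \<leftarrow> rtree_law n; \<sigma> \<leftarrow> jordan2_ordering (graph_of T); return_pmf (T, \<sigma>) }"
  have "ordered_random_recursive_tree n = map_pmf (\<lambda>(T, \<sigma>). (graph_of T, \<sigma>)) D"
    using assms(1) by (simp add: ordered_random_recursive_tree_def random_recursive_tree_eq D_def
      map_bind_pmf bind_map_pmf)
  moreover have "rtree_law n = map_pmf fst D"
    by (simp add: D_def map_bind_pmf bind_return_pmf')
  moreover have "measure_pmf.prob D (fst -` G) \<le>
    measure_pmf.prob D ((\<lambda>(T, \<sigma>). (graph_of T, \<sigma>)) -` {(t, \<sigma>). 1 \<in> top_ranked t \<sigma> \<lceil>k\<rceil>})"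
  proof (rule measure_pmf.finite_measure_mono_AE)
    show "AE x in D. x \<in> fst -` G \<longrightarrow>
      x \<in> (\<lambda>(T, \<sigma>). (graph_of T, \<sigma>)) -` {(t, \<sigma>). 1 \<in> top_ranked t \<sigma> \<lceil>k\<rceil>}"
    proof (rule AE_pmfI, rule impI)
      fix x assume x: "x \<in> set_pmf D" "x \<in> fst -` G"
      then obtain T \<sigma> where T: "x = (T, \<sigma>)" "T \<in> set_pmf (rtree_law n)"
        "\<sigma> \<in> set_pmf (jordan2_ordering (graph_of T))" by (auto simp: D_def)
      have "set_rtree T \<noteq> {}" using root_in_verts[of T] by blast
      then have "\<sigma> \<in> decreasing_rankings (graph_of T) (jordan2 (graph_of T))"
        using T(3) set_jordan2_ordering[of "graph_of T"] by simp
      then have "real (\<sigma> 1) \<le> k" using good[OF T(2)] x T(1) by simp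
      then have "int (\<sigma> 1) \<le> \<lceil>k\<rceil>" by linarith
      then show "x \<in> (\<lambda>(T, \<sigma>). (graph_of T, \<sigma>)) -` {(t, \<sigma>). 1 \<in> top_ranked t \<sigma> \<lceil>k\<rceil>}"
        using T(1) rtree_law_support(2)[OF T(2) assms(1)] assms(1) by (simp add: top_ranked_def)
    qed
  qed auto
  ultimately show ?thesis by simp
qed

section \<open>The splitting of a recursive tree at vertex 2\<close>

text \<open>
  The law of the shape of a recursive tree, generated from the top down instead of vertex by vertex:
  the subtree of the oldest child of the root has uniform size, and given its size it is independent
  of the rest, both being recursive trees themselves. That this agrees with the growth process is
  shown in \<open>avg_grow_sum\<close> and \<open>expectation_rtree_law\<close>.
\<close>

fun split_law :: "nat \<Rightarrow> unit rtree pmf" where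
  "split_law n = (if n \<le> 1 then return_pmf (Single ()) else
     do {
       u \<leftarrow> pmf_of_set {1..n - 1};
       c \<leftarrow> split_law u;
       t \<leftarrow> split_law (n - u);
       return_pmf (Join c t)
     })"

declare split_law.simps [simp del]

definition avg :: "nat \<Rightarrow> (unit rtree \<Rightarrow> real) \<Rightarrow> real" where
  "avg n F = measure_pmf.expectation (split_law n) F"

lemma expectation_bind_finite:
  fixes h :: "'b \<Rightarrow> real"
  assumes "finite (set_pmf p)" "\<And>x. x \<in> set_pmf p \<Longrightarrow> finite (set_pmf (f x))"
  shows "measure_pmf.expectation (p \<bind> f) h =
    measure_pmf.expectation p (\<lambda>x. measure_pmf.expectation (f x) h)"
  using assms by (simp add: pmf_expectation_bind[of "set_pmf p"] integral_measure_pmf[of "set_pmf p"])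

lemma finite_split_law [simp]: "finite (set_pmf (split_law n))"
proof (induction n rule: less_induct)
  case (less n)
  show ?case
  proof (cases "n \<le> 1")
    case True then show ?thesis by (simp add: split_law.simps)
  next
    case False
    then have "finite (set_pmf (split_law u))" "finite (set_pmf (split_law (n - u)))"
      if "u \<in> {1..n - 1}" for u
      using False that by (auto intro!: less)
    then show ?thesis using False by (subst split_law.simps) auto
  qed
qed

lemma vcount_split_law: "T \<in> set_pmf (split_law n) \<Longrightarrow> n \<ge> 1 \<Longrightarrow> vcount T = n"
proof (induction n arbitrary: T rule: less_induct)
  case (less n)
  show ?case
  proof (cases "n \<le> 1")
    case True then show ?thesis using less by (simp add: split_law.simps)
  next
    case False
    then obtain u c t where "u \<in> {1..n - 1}" "c \<in> set_pmf (split_law u)"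
      "t \<in> set_pmf (split_law (n - u))" "T = Join c t"
      using less.prems(1) by (subst (asm) split_law.simps) auto
    then show ?thesis using less.IH[of u c] less.IH[of "n - u" t] by auto
  qed
qed

lemma avg_1 [simp]: "avg (Suc 0) F = F (Single ())"
  by (simp add: avg_def split_law.simps)

lemma avg_integrable [simp]: "integrable (measure_pmf (split_law n)) (F :: _ \<Rightarrow> real)"
  by (intro integrable_measure_pmf_finite finite_split_law)

lemma avg_rec:
  assumes "n \<ge> 2"
  shows "avg n F = (\<Sum>u = 1..n-1. avg u (\<lambda>c. avg (n - u) (\<lambda>t. F (Join c t)))) / real (n - 1)"
proof -
  have "avg n F = (\<Sum>u = 1..n-1. measure_pmf.expectation
     (split_law u \<bind> (\<lambda>c. split_law (n - u) \<bind> (\<lambda>t. return_pmf (Join c t)))) F /\<^sub>R real (card {1..n-1}))"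
    unfolding avg_def using assms
    by (subst split_law.simps) (simp add: pmf_expectation_bind_pmf_of_set)
  also have "\<dots> = (\<Sum>u = 1..n-1. avg u (\<lambda>c. avg (n - u) (\<lambda>t. F (Join c t))) / real (n - 1))"
    unfolding avg_def by (simp add: expectation_bind_finite divide_inverse mult.commute)
  finally show ?thesis by (simp add: sum_divide_distrib)
qed

lemma avg_add: "avg n (\<lambda>T. F T + G T) = avg n F + avg n G"
  by (simp add: avg_def)

lemma avg_cmult: "avg n (\<lambda>T. k * F T) = k * avg n F"
  by (simp add: avg_def)

lemma avg_const [simp]: "avg n (\<lambda>T. k) = k"
  by (simp add: avg_def)

lemma avg_mono:
  assumes "n \<ge> 1" "\<And>T. vcount T = n \<Longrightarrow> F T \<le> G T"
  shows "avg n F \<le> avg n G"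
  unfolding avg_def using assms vcount_split_law
  by (intro integral_mono_AE) (auto simp: AE_measure_pmf_iff)

lemma avg_cong:
  assumes "n \<ge> 1" "\<And>T. vcount T = n \<Longrightarrow> F T = G T"
  shows "avg n F = avg n G"
  using assms by (intro antisym avg_mono) auto

lemma avg_nonneg: "(\<And>T. F T \<ge> 0) \<Longrightarrow> avg n F \<ge> 0"
  by (simp add: avg_def)

text \<open>
  The sum of \<open>F\<close> over the trees obtained by attaching a new vertex to each vertex in turn.
\<close>

fun grow_sum :: "(unit rtree \<Rightarrow> real) \<Rightarrow> unit rtree \<Rightarrow> real" where
  "grow_sum F (Single v) = F (Join (Single ()) (Single ()))"
| "grow_sum F (Join c t) = grow_sum (\<lambda>c'. F (Join c' t)) c + grow_sum (\<lambda>t'. F (Join c t')) t"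

lemma avg_grow_sum_swap:
  "avg k (\<lambda>t. grow_sum (\<lambda>c. G c t) T) = grow_sum (\<lambda>c. avg k (G c)) T"
  by (induction T arbitrary: G) (simp_all add: avg_add)

text \<open>
  The Polya urn computation: if the sizes of the two parts of a tree with \<open>n\<close> vertices are uniform, a
  new vertex joins the part of size \<open>u\<close> with probability \<open>u / n\<close>. Then the part of size \<open>v\<close> in the
  enlarged tree arises with weight proportional to \<open>(v - 1) + (n - v) = n - 1\<close>, which does not depend
  on \<open>v\<close>, so the sizes are uniform again.
\<close>

lemma avg_grow_sum:
  assumes "n \<ge> 1"
  shows "avg n (grow_sum F) = real n * avg (Suc n) F"
  using assms
proof (induction n arbitrary: F rule: less_induct)
  case (less n)
  show ?case
  proof (cases "n = 1")
    case True then show ?thesis by (simp add: avg_rec[of "Suc (Suc 0)"])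
  next
    case False
    then have n: "n \<ge> 2" using less by simp
    define H where "H i j = avg i (\<lambda>c. avg j (\<lambda>t. F (Join c t)))" for i j
    have "avg u (\<lambda>c. avg (n - u) (\<lambda>t. grow_sum F (Join c t)))
      = real u * H (Suc u) (n - u) + real (n - u) * H u (Suc (n - u))" if "u \<in> {1..n-1}" for u
    proof -
      have "avg u (\<lambda>c. avg (n - u) (\<lambda>t. grow_sum F (Join c t))) =
        avg u (grow_sum (\<lambda>c'. avg (n - u) (\<lambda>t. F (Join c' t)))) +
        avg u (\<lambda>c. avg (n - u) (grow_sum (\<lambda>t'. F (Join c t'))))"
        by (simp add: avg_add avg_grow_sum_swap)
      moreover have "avg (n - u) (grow_sum (\<lambda>t'. F (Join c t'))) = real (n - u) * avg (Suc (n - u)) (\<lambda>t'. F (Join c t'))" for c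
        using that n by (intro less.IH) auto
      moreover have "avg u (grow_sum (\<lambda>c'. avg (n - u) (\<lambda>t. F (Join c' t)))) = real u * H (Suc u) (n - u)"
        unfolding H_def using that n by (intro less.IH) auto
      ultimately show ?thesis by (simp add: H_def avg_cmult)
    qed
    then have "avg n (grow_sum F) =
      (\<Sum>u = 1..n-1. real u * H (Suc u) (n - u) + real (n - u) * H u (Suc (n - u))) / real (n - 1)"
      using n by (simp add: avg_rec)
    also have "(\<Sum>u = 1..n-1. real u * H (Suc u) (n - u) + real (n - u) * H u (Suc (n - u))) =
      (\<Sum>u = 1..n-1. real u * H (Suc u) (n - u)) + (\<Sum>u = 1..n-1. real (n - u) * H u (Suc n - u))"
      unfolding sum.distrib by (intro arg_cong2[where f = "(+)"] sum.cong refl) (auto simp: Suc_diff_le)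
    also have "(\<Sum>u = 1..n-1. real u * H (Suc u) (n - u)) = (\<Sum>v = 2..n. real (v - 1) * H v (Suc n - v))"
      using n by (intro sum.reindex_bij_witness[of _ "\<lambda>v. v - 1" Suc]) auto
    also have "\<dots> = (\<Sum>v = 1..n. real (v - 1) * H v (Suc n - v))"
      by (intro sum.mono_neutral_left) auto
    also have "(\<Sum>u = 1..n-1. real (n - u) * H u (Suc n - u)) = (\<Sum>v = 1..n. real (n - v) * H v (Suc n - v))"
      by (intro sum.mono_neutral_left) auto
    also have "(\<Sum>v = 1..n. real (v - 1) * H v (Suc n - v)) + (\<Sum>v = 1..n. real (n - v) * H v (Suc n - v))
      = (\<Sum>v = 1..n. real (n - 1) * H v (Suc n - v))"
      unfolding sum.distrib[symmetric]
      by (intro sum.cong refl) (auto simp: of_nat_diff algebra_simps)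
    also have "\<dots> / real (n - 1) = (\<Sum>v = 1..n. H v (Suc n - v))"
      using n by (simp add: sum_distrib_left[symmetric])
    also have "\<dots> = real n * avg (Suc n) F"
      using n by (simp add: avg_rec H_def)
    finally show ?thesis .
  qed
qed

abbreviation shape :: "'a rtree \<Rightarrow> unit rtree" where
  "shape \<equiv> map_rtree (\<lambda>_. ())"

lemma vcount_map [simp]: "vcount (map_rtree f T) = vcount T"
  by (induction T) auto

lemma kids_map [simp]: "kids (map_rtree f T) = map (map_rtree f) (kids T)"
  by (induction T) auto

lemma heavy_links_map [simp]: "heavy_links X s (map_rtree f T) = heavy_links X s T"
  by (induction T arbitrary: s) auto

lemma sum_attach:
  assumes "distinct_verts T"
  shows "(\<Sum>u \<in> set_rtree T. F (shape (attach u w T))) = grow_sum F (shape T)"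
  using assms
proof (induction T arbitrary: F)
  case (Join c t)
  then have disj: "set_rtree c \<inter> set_rtree t = {}" by simp
  have "(\<Sum>u \<in> set_rtree c. F (shape (attach u w (Join c t)))) =
     (\<Sum>u \<in> set_rtree c. F (Join (shape (attach u w c)) (shape t)))"
    using disj by (intro sum.cong refl) (simp add: attach_notin disjoint_iff)
  moreover have "(\<Sum>u \<in> set_rtree t. F (shape (attach u w (Join c t)))) =
     (\<Sum>u \<in> set_rtree t. F (Join (shape c) (shape (attach u w t))))"
  proof (rule sum.cong[OF refl])
    fix u assume "u \<in> set_rtree t"
    then have "u \<notin> set_rtree c" using disj by blast
    then show "F (shape (attach u w (Join c t))) = F (Join (shape c) (shape (attach u w t)))"
      by (simp add: attach_notin)
  qed
  ultimately show ?case
    using Join.IH(1)[of "\<lambda>c'. F (Join c' (shape t))"] Join.IH(2)[of "\<lambda>t'. F (Join (shape c) t')"]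
      Join.prems disj by (simp add: sum.union_disjoint)
qed simp

text \<open>
  In one step of the growth process the average over the new vertex's parent is \<open>grow_sum\<close> divided by
  the number of vertices, which \<open>avg_grow_sum\<close> identifies with one more vertex in the splitting law.
\<close>

lemma expectation_rtree_law:
  assumes "n \<ge> 1"
  shows "measure_pmf.expectation (rtree_law n) (\<lambda>T. F (shape T)) = avg n F"
  using assms
proof (induction n arbitrary: F rule: rtree_law.induct)
  case (3 m)
  have "measure_pmf.expectation (rtree_law (Suc (Suc m))) (\<lambda>T. F (shape T)) =
    measure_pmf.expectation (rtree_law (Suc m)) (\<lambda>T. measure_pmf.expectation
      (pmf_of_set {1..Suc m} \<bind> (\<lambda>u. return_pmf (attach u (Suc (Suc m)) T))) (\<lambda>T. F (shape T)))"
    by (simp add: expectation_bind_finite)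
  also have "\<dots> = measure_pmf.expectation (rtree_law (Suc m)) (\<lambda>T. grow_sum F (shape T) / real (Suc m))"
  proof (intro integral_cong_AE)
    show "AE T in rtree_law (Suc m). measure_pmf.expectation
      (pmf_of_set {1..Suc m} \<bind> (\<lambda>u. return_pmf (attach u (Suc (Suc m)) T))) (\<lambda>T. F (shape T)) =
      grow_sum F (shape T) / real (Suc m)"
    proof (rule AE_pmfI)
      fix T assume "T \<in> set_pmf (rtree_law (Suc m))"
      then have T: "distinct_verts T" "set_rtree T = {1..Suc m}" using rtree_law_support by auto
      have "measure_pmf.expectation
        (pmf_of_set {1..Suc m} \<bind> (\<lambda>u. return_pmf (attach u (Suc (Suc m)) T))) (\<lambda>T. F (shape T))
        = (\<Sum>u \<in> set_rtree T. F (shape (attach u (Suc (Suc m)) T)) / real (Suc m))"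
        unfolding T(2) by (simp add: pmf_expectation_bind_pmf_of_set divide_inverse mult.commute)
      then show "measure_pmf.expectation
        (pmf_of_set {1..Suc m} \<bind> (\<lambda>u. return_pmf (attach u (Suc (Suc m)) T))) (\<lambda>T. F (shape T))
        = grow_sum F (shape T) / real (Suc m)"
        using sum_attach[OF T(1), of F "Suc (Suc m)"] by (simp only: sum_divide_distrib[symmetric])
    qed
  qed auto
  also have "\<dots> = avg (Suc m) (\<lambda>T. grow_sum F T / real (Suc m))"
    using 3 by (intro "3.IH") simp
  also have "\<dots> = avg (Suc (Suc m)) F"
    using avg_cmult[of "Suc m" "1 / real (Suc m)" "grow_sum F"] avg_grow_sum[of "Suc m" F] by simp
  finally show ?case .
qed simp_all

lemma prob_rtree_law_le:
  assumes "n \<ge> 1"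
    and "\<And>T. T \<in> set_pmf (rtree_law n) \<Longrightarrow> T \<in> B \<Longrightarrow> 1 \<le> F (shape T)"
    and "\<And>S. F S \<ge> 0"
  shows "measure_pmf.prob (rtree_law n) B \<le> avg n F"
proof -
  have "measure_pmf.prob (rtree_law n) B = measure_pmf.expectation (rtree_law n) (indicator B)" by simp
  also have "\<dots> \<le> measure_pmf.expectation (rtree_law n) (\<lambda>T. F (shape T))"
    using assms(2,3)
    by (intro integral_mono_AE integrable_measure_pmf_finite) (auto intro!: AE_pmfI simp: indicator_def)
  finally show ?thesis using expectation_rtree_law[OF assms(1)] by simp
qed

text \<open>
  The expected number of branches of size \<open>s\<close> at the root is \<open>1 / s\<close>, as for the cycles of a uniform
  random permutation, and each branch is again a recursive tree. Iterating the identity handles pairs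
  of a branch and a branch of this branch.
\<close>

lemma avg_kids:
  assumes "n \<ge> 1"
  shows "avg n (\<lambda>T. \<Sum>c\<leftarrow>kids T. h c) = (\<Sum>s = 1..n-1. avg s h / real s)"
  using assms
proof (induction n rule: less_induct)
  case (less n)
  show ?case
  proof (cases "n = 1")
    case True then show ?thesis by simp
  next
    case False
    then have n: "n \<ge> 2" using less by simp
    define g where "g s = avg s h / real s" for s
    have "avg u (\<lambda>c. avg (n - u) (\<lambda>t. \<Sum>c\<leftarrow>kids (Join c t). h c)) = avg u h + (\<Sum>s = 1..n-u-1. g s)"
      if "u \<in> {1..n-1}" for u
      using that less.IH[of "n - u"] by (auto simp: avg_add g_def)
    then have "avg n (\<lambda>T. \<Sum>c\<leftarrow>kids T. h c) =
      ((\<Sum>u = 1..n-1. avg u h) + (\<Sum>u = 1..n-1. \<Sum>s = 1..n-u-1. g s)) / real (n - 1)"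
      using n by (simp add: avg_rec sum.distrib)
    also have "(\<Sum>u = 1..n-1. \<Sum>s = 1..n-u-1. g s) = (\<Sum>u = 1..n-1. \<Sum>s = 1..n-1. if u < n - s then g s else 0)"
    proof (rule sum.cong[OF refl])
      fix u assume "u \<in> {1..n-1}"
      have "(\<Sum>s = 1..n-1. if u < n - s then g s else 0) = (\<Sum>s \<in> {s \<in> {1..n-1}. u < n - s}. g s)"
        by (intro sum.inter_filter[symmetric]) simp
      also have "{s \<in> {1..n-1}. u < n - s} = {1..n-u-1}" by auto
      finally show "(\<Sum>s = 1..n-u-1. g s) = (\<Sum>s = 1..n-1. if u < n - s then g s else 0)" by simp
    qed
    also have "\<dots> = (\<Sum>s = 1..n-1. \<Sum>u = 1..n-1. if u < n - s then g s else 0)" by (rule sum.swap)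
    also have "\<dots> = (\<Sum>s = 1..n-1. real (n - s - 1) * g s)"
    proof (intro sum.cong refl)
      fix s assume s: "s \<in> {1..n-1}"
      have "(\<Sum>u = 1..n-1. if u < n - s then g s else 0) = (\<Sum>u \<in> {u \<in> {1..n-1}. u < n - s}. g s)"
        by (intro sum.inter_filter[symmetric]) simp
      also have "{u \<in> {1..n-1}. u < n - s} = {1..n-s-1}" by auto
      finally show "(\<Sum>u = 1..n-1. if u < n - s then g s else 0) = real (n - s - 1) * g s" by simp
    qed
    also have "(\<Sum>u = 1..n-1. avg u h) = (\<Sum>s = 1..n-1. real s * g s)"
      by (intro sum.cong) (auto simp: g_def)
    also have "(\<Sum>s = 1..n-1. real s * g s) + (\<Sum>s = 1..n-1. real (n - s - 1) * g s) =
      (\<Sum>s = 1..n-1. real (n - 1) * g s)"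
      unfolding sum.distrib[symmetric]
      by (intro sum.cong refl) (auto simp: of_nat_diff algebra_simps)
    also have "\<dots> / real (n - 1) = (\<Sum>s = 1..n-1. g s)"
      using n by (simp add: sum_distrib_left[symmetric])
    finally show ?thesis by (simp add: g_def)
  qed
qed

section \<open>The centrality of the root is rarely small\<close>

lemma inverse_le_ln_diff:
  assumes "i \<ge> (2::nat)"
  shows "1 / real i \<le> ln (real i) - ln (real (i - 1))"
proof -
  have "ln (real (i - 1) / real i) \<le> real (i - 1) / real i - 1"
    using assms by (intro ln_le_minus_one) auto
  also have "\<dots> = - (1 / real i)" using assms by (simp add: field_simps of_nat_diff)
  finally show ?thesis using assms by (simp add: ln_div)
qed

lemma sum_inverse_le_ln:
  assumes "1 \<le> a" "a \<le> b"
  shows "(\<Sum>i = a..b. 1 / real i) \<le> 1 / real a + ln (real b / real a)"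
  using assms(2,1)
proof (induction b rule: dec_induct)
  case base then show ?case by simp
next
  case (step b)
  have "(\<Sum>i = a..Suc b. 1 / real i) \<le> 1 / real a + ln (real b / real a) + 1 / real (Suc b)"
    using step by simp
  also have "\<dots> \<le> 1 / real a + ln (real (Suc b) / real a)"
    using inverse_le_ln_diff[of "Suc b"] step by (simp add: ln_div)
  finally show ?case .
qed

lemma sum_inverse_interval_le:
  assumes "finite I" "1 \<le> A" "A \<le> B" "\<And>i. i \<in> I \<Longrightarrow> A \<le> real i \<and> real i \<le> B"
  shows "(\<Sum>i \<in> I. 1 / real i) \<le> 1 + ln (B / A)"
proof (cases "I = {}")
  case True then show ?thesis using assms by simp
next
  case False
  define a where "a = Min I"
  define b where "b = Max I"
  have ab: "a \<in> I" "b \<in> I" "I \<subseteq> {a..b}" using False assms(1) by (auto simp: a_def b_def)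
  have a1: "1 \<le> a" "A \<le> real a" "real b \<le> B" using assms(2,4) ab by force+
  have "(\<Sum>i \<in> I. 1 / real i) \<le> (\<Sum>i = a..b. 1 / real i)"
    using ab by (intro sum_mono2) auto
  also have "\<dots> \<le> 1 / real a + ln (real b / real a)"
    using a1 ab by (intro sum_inverse_le_ln) auto
  also have "\<dots> \<le> 1 + ln (B / A)"
  proof (intro add_mono)
    show "1 / real a \<le> 1" using a1 by simp
    have "real b \<ge> real a" using ab by auto
    then have "real b / real a \<le> B / A" using a1 assms(2) by (intro frac_le) auto
    then show "ln (real b / real a) \<le> ln (B / A)" using a1 ab by (intro ln_mono) auto
  qed
  finally show ?thesis .
qed

lemma card_nat_le:
  assumes "\<And>i. i \<in> I \<Longrightarrow> 1 \<le> i \<and> real i \<le> x" "x \<ge> 0"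
  shows "real (card I) \<le> x"
proof -
  have "I \<subseteq> {1..nat \<lfloor>x\<rfloor>}" using assms by (auto simp: le_nat_iff le_floor_iff)
  then have "card I \<le> card {1..nat \<lfloor>x\<rfloor>}" by (intro card_mono) auto
  then have "real (card I) \<le> real (nat \<lfloor>x\<rfloor>)" by simp
  also have "\<dots> \<le> x" using assms(2) by simp
  finally show ?thesis .
qed

text \<open>
  Counts the configurations that \<open>jordan2_root\<close> leaves when the value of the root is below
  \<open>X = x * n\<^sup>2\<close>: with \<open>i = n - |a|\<close>, either \<open>i * |a| < X\<close>, which together with \<open>i\<^sup>2 < X\<close> gives
  \<open>i * n < 2 * X\<close>, that is \<open>i < 2 * x * n\<close>; or \<open>i\<close> is at least \<open>2 * x * n\<close>, still with \<open>i\<^sup>2 < X\<close>, and some branch \<open>b\<close> of \<open>a\<close> satisfies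
  \<open>i * (n - |b|) < X\<close>.
\<close>

definition close_branches :: "real \<Rightarrow> nat \<Rightarrow> unit rtree \<Rightarrow> real" where
  "close_branches x n T = (\<Sum>a\<leftarrow>kids T. of_bool (real (n - vcount a) < 2 * x * n) +
     (\<Sum>b\<leftarrow>kids a. of_bool (2 * x * n \<le> real (n - vcount a) \<and> (real (n - vcount a))\<^sup>2 < x * (real n)\<^sup>2 \<and>
        real (n - vcount a) * real (n - vcount b) < x * (real n)\<^sup>2)))"

text \<open>
  Write \<open>i = n - |a|\<close> and \<open>j = n - |b|\<close>. All sizes \<open>|a|\<close> and \<open>|b|\<close> that occur are at least \<open>n / 2\<close>, so by
  \<open>avg_kids\<close> each pair \<open>(i, j)\<close> has weight at most \<open>(2 / n)\<^sup>2\<close>. For given \<open>i\<close> there are at most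
  \<open>x * n\<^sup>2 / i\<close> values of \<open>j\<close>, and the harmonic sum over \<open>2 * x * n \<le> i \<le> sqrt x * n\<close> is responsible for the
  logarithm.
\<close>

lemma avg_close_branches:
  assumes x: "0 < x" "x \<le> 1/16" and n: "n \<ge> 2"
  shows "avg n (close_branches x n) \<le> 8 * x + 4 * x * ln (1 / x)"
proof -
  let ?P = "\<lambda>i j. 2 * x * n \<le> real i \<and> (real i)\<^sup>2 < x * (real n)\<^sup>2 \<and> real i * real j < x * (real n)\<^sup>2"
  have "avg n (close_branches x n) = (\<Sum>s = 1..n-1. avg s (\<lambda>a. of_bool (real (n - vcount a) < 2 * x * n) +
     (\<Sum>b\<leftarrow>kids a. of_bool (?P (n - vcount a) (n - vcount b)))) / real s)"
    unfolding close_branches_def using n by (subst avg_kids) auto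
  also have "\<dots> = (\<Sum>s = 1..n-1. (of_bool (real (n - s) < 2 * x * n) +
     (\<Sum>r = 1..s-1. of_bool (?P (n - s) (n - r)) / real r)) / real s)"
  proof (intro sum.cong refl arg_cong2[where f = "(/)"])
    fix s assume s: "s \<in> {1..n-1}"
    have "avg s (\<lambda>a. of_bool (real (n - vcount a) < 2 * x * n) +
       (\<Sum>b\<leftarrow>kids a. of_bool (?P (n - vcount a) (n - vcount b)))) =
      avg s (\<lambda>a. of_bool (real (n - s) < 2 * x * n) + (\<Sum>b\<leftarrow>kids a. of_bool (?P (n - s) (n - vcount b))))"
      using s by (intro avg_cong) auto
    also have "\<dots> = of_bool (real (n - s) < 2 * x * n) +
       (\<Sum>r = 1..s-1. avg r (\<lambda>b. of_bool (?P (n - s) (n - vcount b))) / real r)"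
      using s by (simp add: avg_add avg_kids)
    also have "(\<Sum>r = 1..s-1. avg r (\<lambda>b. of_bool (?P (n - s) (n - vcount b))) / real r) =
      (\<Sum>r = 1..s-1. of_bool (?P (n - s) (n - r)) / real r)"
    proof (rule sum.cong[OF refl])
      fix r assume r: "r \<in> {1..s-1}"
      have "avg r (\<lambda>b. of_bool (?P (n - s) (n - vcount b))) = avg r (\<lambda>b. of_bool (?P (n - s) (n - r)))"
        using r by (intro avg_cong) auto
      then show "avg r (\<lambda>b. of_bool (?P (n - s) (n - vcount b))) / real r = of_bool (?P (n - s) (n - r)) / real r"
        by simp
    qed
    finally show "avg s (\<lambda>a. of_bool (real (n - vcount a) < 2 * x * n) +
       (\<Sum>b\<leftarrow>kids a. of_bool (?P (n - vcount a) (n - vcount b)))) =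
       of_bool (real (n - s) < 2 * x * n) + (\<Sum>r = 1..s-1. of_bool (?P (n - s) (n - r)) / real r)" .
  qed
  also have "\<dots> = (\<Sum>i = 1..n-1. (of_bool (real i < 2 * x * n) +
     (\<Sum>r = 1..n-i-1. of_bool (?P i (n - r)) / real r)) / real (n - i))"
    by (intro sum.reindex_bij_witness[of _ "\<lambda>i. n - i" "\<lambda>i. n - i"]) auto
  also have "\<dots> = (\<Sum>i = 1..n-1. of_bool (real i < 2 * x * n) / real (n - i)) +
     (\<Sum>i = 1..n-1. (\<Sum>r = 1..n-i-1. of_bool (?P i (n - r)) / real r) / real (n - i))"
    by (simp add: add_divide_distrib sum.distrib)
  also have "(\<Sum>i = 1..n-1. of_bool (real i < 2 * x * n) / real (n - i)) \<le> 4 * x"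
  proof -
    let ?I = "{i \<in> {1..n-1}. real i < 2 * x * n}"
    have "(\<Sum>i = 1..n-1. of_bool (real i < 2 * x * n) / real (n - i)) \<le>
      (\<Sum>i = 1..n-1. if real i < 2 * x * n then 2 / real n else 0)"
    proof (rule sum_mono)
      fix i assume i: "i \<in> {1..n-1}"
      have "1 / real (n - i) \<le> 2 / real n" if "real i < 2 * x * n"
      proof -
        have "2 * x * n \<le> 1/2 * n" using x by (intro mult_right_mono) auto
        then have "real i < real n / 2" using that by linarith
        moreover have "real (n - i) = real n - real i" using i by auto
        ultimately have "real n \<le> 2 * real (n - i)" by linarith
        then show ?thesis using i n by (simp add: field_simps)
      qed
      then show "of_bool (real i < 2 * x * n) / real (n - i) \<le> (if real i < 2 * x * n then 2 / real n else 0)"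
        by simp
    qed
    also have "\<dots> = (\<Sum>i \<in> ?I. 2 / real n)" by (intro sum.inter_filter[symmetric]) simp
    also have "\<dots> = real (card ?I) * (2 / real n)" by simp
    also have "\<dots> \<le> (2 * x * n) * (2 / real n)"
      using x by (intro mult_right_mono card_nat_le) auto
    finally show ?thesis using n by simp
  qed
  also have "(\<Sum>i = 1..n-1. (\<Sum>r = 1..n-i-1. of_bool (?P i (n - r)) / real r) / real (n - i)) \<le>
    4 * x * (1 + ln (1 / x))"
  proof -
    let ?I = "{i \<in> {1..n-1}. 2 * x * n \<le> real i \<and> real i \<le> sqrt x * n}"
    have sx: "sqrt x \<le> 1/4" using x real_sqrt_le_mono[of x "1/16"] by (simp add: real_sqrt_divide)
    have inner: "(\<Sum>r = 1..n-i-1. of_bool (?P i (n - r)) / real r) / real (n - i) \<le>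
      (if 2 * x * n \<le> real i \<and> real i \<le> sqrt x * n then 4 * x * (1 / real i) else 0)"
      if i: "i \<in> {1..n-1}" for i
    proof (cases "2 * x * n \<le> real i \<and> (real i)\<^sup>2 < x * (real n)\<^sup>2")
      case False
      then have "(\<Sum>r = 1..n-i-1. of_bool (?P i (n - r)) / real r) = 0" by (intro sum.neutral) auto
      then show ?thesis using x by simp
    next
      case True
      have "(real i)\<^sup>2 \<le> (sqrt x * n)\<^sup>2" using True x by (simp add: power_mult_distrib)
      then have ix: "real i \<le> sqrt x * n" by (rule power2_le_imp_le) (use x in simp)
      also have "\<dots> \<le> 1/4 * n" using sx by (intro mult_right_mono) auto
      finally have "real n \<le> 2 * real (n - i)" using i by (simp add: of_nat_diff)
      then have ni: "1 / real (n - i) \<le> 2 / real n" using i n by (simp add: field_simps)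
      let ?J = "{r \<in> {1..n-i-1}. real i * real (n - r) < x * (real n)\<^sup>2}"
      have "(\<Sum>r = 1..n-i-1. of_bool (?P i (n - r)) / real r) \<le>
        (\<Sum>r = 1..n-i-1. if real i * real (n - r) < x * (real n)\<^sup>2 then 2 / real n else 0)"
      proof (rule sum_mono)
        fix r assume r: "r \<in> {1..n-i-1}"
        have "1 / real r \<le> 2 / real n" if h: "real i * real (n - r) < x * (real n)\<^sup>2"
        proof -
          have "2 * x * n * real (n - r) \<le> real i * real (n - r)" using True by (intro mult_right_mono) auto
          also have "\<dots> < x * n * n" using h by (simp add: power2_eq_square mult.assoc)
          finally have "x * n * (2 * real (n - r)) < x * n * n" by (simp add: algebra_simps)
          then have "2 * real (n - r) < n" using x n by (simp add: mult_less_cancel_left_pos)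
          then have "real n \<le> 2 * real r" using r by (simp add: of_nat_diff)
          then show ?thesis using r n by (simp add: field_simps)
        qed
        then show "of_bool (?P i (n - r)) / real r \<le>
          (if real i * real (n - r) < x * (real n)\<^sup>2 then 2 / real n else 0)" by auto
      qed
      also have "\<dots> = (\<Sum>r \<in> ?J. 2 / real n)" by (intro sum.inter_filter[symmetric]) simp
      also have "\<dots> = real (card ?J) * (2 / real n)" by simp
      also have "card ?J = card ((\<lambda>r. n - r) ` ?J)"
        by (intro card_image[symmetric] inj_onI) auto
      also have "real (card ((\<lambda>r. n - r) ` ?J)) * (2 / real n) \<le> (x * (real n)\<^sup>2 / real i) * (2 / real n)"
        using x i by (intro mult_right_mono card_nat_le) (auto simp: field_simps)
      also have "\<dots> = 2 * x * n / real i" using n by (simp add: power2_eq_square)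
      finally have "(\<Sum>r = 1..n-i-1. of_bool (?P i (n - r)) / real r) * (1 / real (n - i)) \<le>
        (2 * x * n / real i) * (2 / real n)"
        using ni x by (intro mult_mono) auto
      then show ?thesis using True ix n by simp
    qed
    have "(\<Sum>i = 1..n-1. (\<Sum>r = 1..n-i-1. of_bool (?P i (n - r)) / real r) / real (n - i)) \<le>
      (\<Sum>i = 1..n-1. if 2 * x * n \<le> real i \<and> real i \<le> sqrt x * n then 4 * x * (1 / real i) else 0)"
      using inner by (rule sum_mono)
    also have "\<dots> = (\<Sum>i \<in> ?I. 4 * x * (1 / real i))" by (intro sum.inter_filter[symmetric]) simp
    also have "\<dots> = 4 * x * (\<Sum>i \<in> ?I. 1 / real i)" by (simp add: sum_distrib_left)
    also have "\<dots> \<le> 4 * x * (1 + ln (1 / x))"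
    proof (intro mult_left_mono)
      show "(\<Sum>i \<in> ?I. 1 / real i) \<le> 1 + ln (1 / x)"
      proof (cases "max 1 (2 * x * n) \<le> sqrt x * n")
        case True
        have "sqrt x * n / max 1 (2 * x * n) \<le> sqrt x * n / (2 * x * n)"
          using x n by (intro divide_left_mono) auto
        also have "\<dots> = 1 / (2 * sqrt x)" using x n by (simp add: field_simps)
        also have "\<dots> \<le> 1 / x"
        proof (intro divide_left_mono)
          have "x = sqrt x * sqrt x" using x by simp
          also have "\<dots> \<le> 2 * sqrt x" using sx x by (intro mult_right_mono) auto
          finally show "x \<le> 2 * sqrt x" .
        qed (use x in auto)
        finally have q: "sqrt x * n / max 1 (2 * x * n) \<le> 1 / x" .
        have "(\<Sum>i \<in> ?I. 1 / real i) \<le> 1 + ln (sqrt x * n / max 1 (2 * x * n))"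
          using True by (intro sum_inverse_interval_le) auto
        also have "\<dots> \<le> 1 + ln (1 / x)"
          using q x n by (intro add_left_mono ln_mono) auto
        finally show ?thesis .
      next
        case False
        then have empty: "?I = {}" by auto
        have "ln (1 / x) \<ge> 0" using x by (intro ln_ge_zero) simp
        then show ?thesis unfolding empty by simp
      qed
    qed (use x in auto)
    finally show ?thesis .
  qed
  finally show ?thesis by (simp add: algebra_simps)
qed

lemma prob_jordan2_root_small:
  assumes x: "0 < x" "x \<le> 1/16" and n: "n \<ge> 2"
  shows "measure_pmf.prob (rtree_law n) {T. real (jordan2 (graph_of T) (root_of T)) < x * (real n)\<^sup>2} \<le>
    8 * x + 4 * x * ln (1 / x)"
proof -
  have "measure_pmf.prob (rtree_law n) {T. real (jordan2 (graph_of T) (root_of T)) < x * (real n)\<^sup>2} \<le>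
    avg n (close_branches x n)"
  proof (rule prob_rtree_law_le)
    fix T assume T: "T \<in> set_pmf (rtree_law n)"
      and "T \<in> {T. real (jordan2 (graph_of T) (root_of T)) < x * (real n)\<^sup>2}"
    then have small: "real (jordan2 (graph_of T) (root_of T)) < x * (real n)\<^sup>2" by simp
    have dv: "distinct_verts T" and vc: "vcount T = n"
      using rtree_law_support[OF T] vcount_rtree_law[OF T] n by auto
    obtain a where a: "a \<in> set (kids T)"
      "(n - vcount a)\<^sup>2 \<le> jordan2 (graph_of T) (root_of T)"
      "(n - vcount a) * vcount a \<le> jordan2 (graph_of T) (root_of T) \<or>
        (\<exists>b \<in> set (kids a). (n - vcount a) * (n - vcount b) \<le> jordan2 (graph_of T) (root_of T))"
      using jordan2_root[OF dv] vc n by metis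
    have lt: "real k < x * (real n)\<^sup>2" if "k \<le> jordan2 (graph_of T) (root_of T)" for k
      using that small by (simp add: le_less_trans[of _ "real (jordan2 (graph_of T) (root_of T))"])
    have sq: "(real (n - vcount a))\<^sup>2 < x * (real n)\<^sup>2" using lt[OF a(2)] by simp
    let ?h = "\<lambda>a. of_bool (real (n - vcount a) < 2 * x * n) +
     (\<Sum>b\<leftarrow>kids a. of_bool (2 * x * n \<le> real (n - vcount a) \<and> (real (n - vcount a))\<^sup>2 < x * (real n)\<^sup>2 \<and>
        real (n - vcount a) * real (n - vcount b) < x * (real n)\<^sup>2)) :: real"
    have an: "vcount a < n" using kids_vcount[OF a(1)] vc by simp
    have h1: "1 \<le> ?h (shape a)"
    proof (cases "real (n - vcount a) < 2 * x * n")
      case True then show ?thesis by (auto intro!: sum_list_nonneg)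
    next
      case False
      have "\<not> (n - vcount a) * vcount a \<le> jordan2 (graph_of T) (root_of T)"
      proof
        assume "(n - vcount a) * vcount a \<le> jordan2 (graph_of T) (root_of T)"
        then have "real (n - vcount a) * real (vcount a) < x * (real n)\<^sup>2" using lt by fastforce
        then have "real (n - vcount a) * (real (vcount a) + real (n - vcount a)) < 2 * x * (real n)\<^sup>2"
          using sq by (simp add: algebra_simps power2_eq_square)
        then have "real (n - vcount a) * n < 2 * x * n * n"
          using an by (simp add: of_nat_diff power2_eq_square mult.assoc)
        then show False using False n by (simp add: mult_less_cancel_right_pos)
      qed
      then obtain b where b: "b \<in> set (kids a)" "(n - vcount a) * (n - vcount b) \<le> jordan2 (graph_of T) (root_of T)"
        using a(3) by blast
      have "real (n - vcount a) * real (n - vcount b) < x * (real n)\<^sup>2" using lt[OF b(2)] by simp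
      then have "(1::real) \<le> (\<Sum>b\<leftarrow>kids (shape a). of_bool (2 * x * n \<le> real (n - vcount a) \<and>
        (real (n - vcount a))\<^sup>2 < x * (real n)\<^sup>2 \<and> real (n - vcount a) * real (n - vcount b) < x * (real n)\<^sup>2))"
        using b(1) sq False by (intro member_le_sum_list[THEN order_trans[rotated]]) force+
      then show ?thesis using False by simp
    qed
    also have "?h (shape a) \<le> close_branches x n (shape T)"
      unfolding close_branches_def using a(1)
      by (intro member_le_sum_list) (auto intro!: add_nonneg_nonneg sum_list_nonneg)
    finally show "1 \<le> close_branches x n (shape T)" .
  qed (use n in \<open>auto simp: close_branches_def intro!: sum_list_nonneg\<close>)
  then show ?thesis using avg_close_branches[OF assms] by simp
qed

section \<open>The number of heavy links\<close>

text \<open>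
  All products of sizes that occur are at most \<open>vcount T * s\<close>.
\<close>

lemma heavy_links_eq_0:
  assumes "real (vcount T * s) < X" "vcount T \<le> s"
  shows "heavy_links X s T = 0"
  using assms
proof (induction T arbitrary: s)
  case (Join c t)
  have "vcount c * s \<le> vcount (Join c t) * s" "vcount t * s \<le> vcount (Join c t) * s"
    "vcount c * vcount c \<le> vcount (Join c t) * s"
    using Join.prems(2) by (auto intro!: mult_le_mono)
  then have "real (vcount c * s) < X" "real (vcount t * s) < X" "real (vcount c * vcount c) < X"
    using Join.prems(1) by (meson of_nat_le_iff le_less_trans)+
  then show ?case using Join.IH[of "vcount c"] Join.IH(2)[of s] Join.prems(2) by simp
qed simp

text \<open>
  An exponential moment of the number of links with product at least \<open>m\<^sup>2\<close>. The base \<open>4 / 3\<close> has to be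
  small: the induction step in \<open>heavy_mgf_small\<close> closes only for bases up to \<open>24 / 17\<close>.
\<close>

definition heavy_mgf :: "real \<Rightarrow> nat \<Rightarrow> nat \<Rightarrow> real" where
  "heavy_mgf m n s = avg n (\<lambda>T. (4 / 3) ^ heavy_links (m\<^sup>2) s T)"

lemma heavy_mgf_nonneg: "heavy_mgf m n s \<ge> 0"
  unfolding heavy_mgf_def by (intro avg_nonneg) simp

lemma heavy_mgf_eq_1:
  assumes "n \<ge> 1" "n \<le> s" "real n * real s < m\<^sup>2"
  shows "heavy_mgf m n s = 1"
proof -
  have "heavy_mgf m n s = avg n (\<lambda>T. 1)"
    unfolding heavy_mgf_def using assms by (intro avg_cong) (auto simp: heavy_links_eq_0)
  then show ?thesis by simp
qed

lemma heavy_mgf_rec: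
  assumes "n \<ge> 2"
  shows "heavy_mgf m n s \<le> 4 / 3 * (\<Sum>u = 1..n-1. heavy_mgf m u u * heavy_mgf m (n - u) s) / real (n - 1)"
proof -
  have "heavy_mgf m n s = (\<Sum>u = 1..n-1. avg u (\<lambda>c. avg (n - u) (\<lambda>t.
    (4 / 3) ^ heavy_links (m\<^sup>2) s (Join c t)))) / real (n - 1)"
    unfolding heavy_mgf_def using assms by (rule avg_rec)
  also have "\<dots> \<le> (\<Sum>u = 1..n-1. 4 / 3 * (heavy_mgf m u u * heavy_mgf m (n - u) s)) / real (n - 1)"
  proof (intro divide_right_mono sum_mono)
    fix u assume u: "u \<in> {1..n-1}"
    have "avg u (\<lambda>c. avg (n - u) (\<lambda>t. (4 / 3) ^ heavy_links (m\<^sup>2) s (Join c t))) \<le>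
      avg u (\<lambda>c. avg (n - u) (\<lambda>t. (4 / 3 * (4 / 3) ^ heavy_links (m\<^sup>2) u c) * (4 / 3) ^ heavy_links (m\<^sup>2) s t))"
      using u by (intro avg_mono) (auto simp: power_add)
    also have "\<dots> = avg u (\<lambda>c. (4 / 3 * (4 / 3) ^ heavy_links (m\<^sup>2) u c) * heavy_mgf m (n - u) s)"
      by (simp only: avg_cmult heavy_mgf_def)
    also have "\<dots> = avg u (\<lambda>c. (4 / 3 * heavy_mgf m (n - u) s) * (4 / 3) ^ heavy_links (m\<^sup>2) u c)"
      by (simp only: mult_ac)
    also have "\<dots> = (4 / 3 * heavy_mgf m (n - u) s) * heavy_mgf m u u"
      by (simp only: avg_cmult heavy_mgf_def)
    also have "\<dots> = 4 / 3 * (heavy_mgf m u u * heavy_mgf m (n - u) s)" by simp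
    finally show "avg u (\<lambda>c. avg (n - u) (\<lambda>t. (4 / 3) ^ heavy_links (m\<^sup>2) s (Join c t))) \<le>
      4 / 3 * (heavy_mgf m u u * heavy_mgf m (n - u) s)" .
  qed simp
  finally show ?thesis by (simp add: sum_distrib_left)
qed

lemma sum_upto_pred: "(\<Sum>u = 1..n-1. real u) = real n * (real n - 1) / 2"
proof (induction n)
  case (Suc n)
  then show ?case by (cases n) (auto simp: field_simps)
qed simp

lemma sum_reflect:
  fixes f :: "nat \<Rightarrow> real"
  shows "(\<Sum>u = 1..n-1. f (n - u)) = (\<Sum>r = 1..n-1. f r)"
  by (intro sum.reindex_bij_witness[of _ "\<lambda>r. n - r" "\<lambda>r. n - r"]) auto

text \<open>
  A piece of size \<open>s < m\<close> whose root has a full subtree of size \<open>t\<close> contains heavy links only at the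
  root, because all products below are less than \<open>m\<^sup>2\<close>. Their number is about \<open>ln (s * t / m\<^sup>2)\<close>, so the
  moment grows like a power of \<open>s * t / m\<^sup>2\<close>, and \<open>1 / 2\<close> is a sufficient exponent. In the step the
  square root is replaced by an affine majorant, because the relative size \<open>(s - u) / s\<close> of the rest has
  average exactly \<open>1 / 2\<close>.
\<close>

lemma heavy_mgf_small:
  assumes m: "m \<ge> 1" and "1 \<le> s" "real s < m" "s \<le> t"
  shows "heavy_mgf m s t \<le> max 1 (3 * sqrt (real s * real t) / m)"
  using assms(2-)
proof (induction s rule: less_induct)
  case (less s)
  show ?case
  proof (cases "real s * real t < m\<^sup>2 \<or> s = 1")
    case True
    then have "heavy_mgf m s t = 1"
      using heavy_mgf_eq_1[of s t m] less.prems by (auto simp: heavy_mgf_def)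
    then show ?thesis by simp
  next
    case False
    then have s2: "s \<ge> 2" using less.prems by auto
    define w where "w = sqrt (real s * real t) / m"
    have "m \<le> sqrt (real s * real t)" using False by (intro real_le_rsqrt) simp
    then have w1: "w \<ge> 1" using m by (simp add: w_def)
    have "heavy_mgf m u u * heavy_mgf m (s - u) t \<le> w * (1 + 9 / 4 * (real (s - u) / real s))"
      if u: "u \<in> {1..s-1}" for u
    proof -
      define z where "z = real (s - u) / real s"
      have z0: "z \<ge> 0" by (simp add: z_def)
      have "real u * real u < m * m" using u less.prems m by (intro mult_strict_mono) auto
      then have "heavy_mgf m u u = 1"
        using u by (intro heavy_mgf_eq_1) (auto simp: power2_eq_square)
      moreover have "heavy_mgf m (s - u) t \<le> max 1 (3 * sqrt (real (s - u) * real t) / m)"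
        using u less.prems by (intro less.IH) auto
      moreover have "3 * sqrt (real (s - u) * real t) / m = 3 * w * sqrt z"
        using u by (simp add: w_def z_def real_sqrt_mult real_sqrt_divide)
      \<comment> \<open>The tangent of the square root at \<open>4 / 9\<close>.\<close>
      moreover have "sqrt z \<le> 1 / 3 + 3 / 4 * z"
      proof -
        have "0 \<le> (sqrt z - 2 / 3)\<^sup>2" by simp
        then show ?thesis using z0 by (simp add: power2_diff power_divide)
      qed
      then have "3 * w * sqrt z \<le> 3 * w * (1 / 3 + 3 / 4 * z)" using w1 by (intro mult_left_mono) auto
      then have "3 * w * sqrt z \<le> w * (1 + 9 / 4 * z)" by (simp add: algebra_simps)
      moreover have "1 \<le> w * (1 + 9 / 4 * z)"
        using mult_mono[of 1 w 1 "1 + 9 / 4 * z"] w1 z0 by simp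
      ultimately show ?thesis unfolding z_def[symmetric] by simp
    qed
    then have "(\<Sum>u = 1..s-1. heavy_mgf m u u * heavy_mgf m (s - u) t) \<le>
      (\<Sum>u = 1..s-1. w * (1 + 9 / 4 * (real (s - u) / real s)))" by (rule sum_mono)
    also have "\<dots> = (\<Sum>r = 1..s-1. w * (1 + 9 / 4 * (real r / real s)))" by (rule sum_reflect)
    also have "\<dots> = w * (real (s - 1) + 9 / 4 * ((\<Sum>r = 1..s-1. real r) / real s))"
      by (simp add: sum_distrib_left[symmetric] sum.distrib sum_divide_distrib[symmetric])
    also have "\<dots> = w * (17 / 8) * real (s - 1)"
      using s2 unfolding sum_upto_pred by (simp add: of_nat_diff field_simps)
    finally have "4 / 3 * (\<Sum>u = 1..s-1. heavy_mgf m u u * heavy_mgf m (s - u) t) / real (s - 1) \<le>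
      4 / 3 * (w * (17 / 8))" using s2 by (simp add: field_simps)
    also have "\<dots> \<le> 3 * w" using w1 by simp
    finally have "heavy_mgf m s t \<le> 3 * w" by (rule order_trans[OF heavy_mgf_rec[OF s2]])
    then show ?thesis by (simp add: w_def)
  qed
qed

lemma sum_inverse_sqrt_le: "(\<Sum>r = 1..n. 1 / sqrt (real r)) \<le> 2 * sqrt (real n)"
proof (induction n)
  case (Suc n)
  have "1 / sqrt (real (Suc n)) \<le> 2 * (sqrt (real (Suc n)) - sqrt (real n))"
  proof -
    have "2 * sqrt (real n) * sqrt (real (Suc n)) \<le> (sqrt (real n))\<^sup>2 + (sqrt (real (Suc n)))\<^sup>2"
      by (rule sum_squares_bound)
    then have "1 \<le> 2 * (sqrt (real (Suc n)) - sqrt (real n)) * sqrt (real (Suc n))"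
      by (simp add: algebra_simps)
    then show ?thesis by (simp add: field_simps del: of_nat_Suc)
  qed
  then show ?case using Suc by simp
qed simp

lemma sum_exp_neg_le:
  assumes "a > 0"
  shows "(\<Sum>u = 1..n. exp (- a * real u)) \<le> 1 / a"
proof -
  have "(\<Sum>u = 1..n. exp (- a * real u)) \<le> (1 - exp (- a * real n)) / a"
  proof (induction n)
    case (Suc n)
    have "1 + a \<le> exp a" by (rule exp_ge_add_one_self)
    then have "exp (- a * real (Suc n)) * (1 + a) \<le> exp (- a * real (Suc n)) * exp a"
      by (intro mult_left_mono) auto
    also have "\<dots> = exp (- a * real n)" by (simp add: exp_add[symmetric] algebra_simps)
    finally have "a * exp (- a * real (Suc n)) \<le> exp (- a * real n) - exp (- a * real (Suc n))"
      by (simp add: algebra_simps)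
    then have "exp (- a * real (Suc n)) \<le> (exp (- a * real n) - exp (- a * real (Suc n))) / a"
      using assms by (simp add: field_simps)
    then show ?case using Suc by (simp add: diff_divide_distrib del: of_nat_Suc)
  qed simp
  also have "\<dots> \<le> 1 / a" using assms by (intro divide_right_mono) auto
  finally show ?thesis .
qed

lemma exp_40_ge: "(9600::real) \<le> exp 40"
proof -
  have "(2::real) ^ 40 \<le> (exp 1) ^ 40" using exp_ge_add_one_self[of 1] by (intro power_mono) auto
  also have "\<dots> = exp (40::real)" by (simp add: exp_of_nat_mult[symmetric])
  finally show ?thesis by simp
qed

text \<open>
  For \<open>s \<ge> m\<close> the number of heavy links in a piece is of order \<open>s / m\<close>, plus a logarithmic number of
  links from the root to small branches, which the factor \<open>sqrt (t / s)\<close> pays for. In the induction the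
  piece is split into sizes \<open>u\<close> and \<open>r = s - u\<close>, and \<open>k u\<close> bounds the product of the two moments
  relative to the claimed bound \<open>W\<close>. If both parts are large, the prefactor \<open>1 / 16\<close> occurs twice and wins;
  here it matters that the exponent of \<open>s / r\<close> is less than \<open>1\<close>, since then the average over \<open>r\<close> stays
  bounded. If a part is small, the exponential decay in its size makes its contribution small on average,
  and if both are small, \<open>exp 40\<close> outweighs the prefactor. On average \<open>k\<close> is at most \<open>3 / 4\<close>, which
  compensates the base \<open>4 / 3\<close>.
\<close>

lemma heavy_mgf_large:
  assumes m: "m \<ge> 1" and "real s \<ge> m" "s \<le> t"
  shows "heavy_mgf m s t \<le> 1 / 16 * exp (40 * real s / m) * sqrt (real t / real s)"
  using assms(2-)
proof (induction s arbitrary: t rule: less_induct)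
  case (less s)
  have s1: "s \<ge> 1" using m less.prems by (cases s) auto
  define W where "W = 1 / 16 * exp (40 * real s / m) * sqrt (real t / real s)"
  have "40 * 1 \<le> 40 * (real s / m)" using less.prems m by (intro mult_left_mono) auto
  then have e40: "exp 40 \<le> exp (40 * real s / m)" by simp
  have W0: "W > 0" using s1 less.prems by (simp add: W_def)
  show ?case
  proof (cases "s = 1")
    case True
    have "1 / 16 * exp 40 * 1 \<le> W" unfolding W_def
      using e40 True less.prems by (intro mult_mono) auto
    then have "1 \<le> W" using exp_40_ge by simp
    then show ?thesis using True by (simp add: heavy_mgf_def W_def)
  next
    case False
    then have s2: "s \<ge> 2" using s1 by simp
    define k where "k u = exp (- (39 / m) * real u) + 1 / 100 + 1 / 16 * sqrt (real s) * (1 / sqrt (real (s - u)))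
      + 3 * (real s / m) * exp (- (40 / m) * real (s - u))" for u
    have split: "heavy_mgf m u u * heavy_mgf m (s - u) t \<le> W * k u" if u: "u \<in> {1..s-1}" for u
    proof -
      define r where "r = s - u"
      have ur: "real u + real r = real s" "r \<ge> 1" "r < s" "u < s" "u \<ge> 1" using u by (auto simp: r_def)
      have Wr: "1 / 16 * exp (40 * real s / m) * sqrt (real t) = W * sqrt (real s)"
        using s1 by (simp add: W_def real_sqrt_divide)
      have exps: "exp (40 * real s / m) = exp (40 * real u / m) * exp (40 * real r / m)"
        by (simp add: ur(1)[symmetric] exp_add[symmetric] add_divide_distrib algebra_simps)
      have g_small: "heavy_mgf m u u = 1" if "real u < m"
      proof -
        have "real u * real u < m * m" using that m by (intro mult_strict_mono) auto
        then show ?thesis using ur by (intro heavy_mgf_eq_1) (auto simp: power2_eq_square)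
      qed
      have g_large: "heavy_mgf m u u \<le> 1 / 16 * exp (40 * real u / m)" if "\<not> real u < m"
        using less.IH[of u u] that ur by simp
      have h_small: "heavy_mgf m r t \<le> 3 * sqrt (real t / m)" if "real r < m"
      proof -
        have "heavy_mgf m r t \<le> max 1 (3 * sqrt (real r * real t) / m)"
          using that m ur less.prems by (intro heavy_mgf_small) auto
        moreover have "1 \<le> 3 * sqrt (real t / m)"
        proof -
          have "1 \<le> sqrt (real t / m)" using less.prems m by simp
          then show ?thesis by linarith
        qed
        moreover have "sqrt (real r * real t) / m \<le> sqrt (real t / m)"
        proof -
          have "sqrt (real r * real t) \<le> sqrt (m * real t)" using that by (intro real_sqrt_le_mono mult_right_mono) auto
          also have "\<dots> = m * sqrt (real t / m)"
            using m by (simp add: real_sqrt_mult real_sqrt_divide field_simps)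
          finally show ?thesis using m by (simp add: field_simps)
        qed
        ultimately show ?thesis by simp
      qed
      have h_large: "heavy_mgf m r t \<le> 1 / 16 * exp (40 * real r / m) * sqrt (real t / real r)" if "\<not> real r < m"
        using less.IH[of r t] that ur less.prems by simp
      have k_parts: "0 \<le> exp (- (39 / m) * real u)" "0 \<le> 1 / 16 * sqrt (real s) * (1 / sqrt (real r))"
        "0 \<le> 3 * (real s / m) * exp (- (40 / m) * real r)" using m by auto
      have "heavy_mgf m u u * heavy_mgf m r t \<le> W * k u"
      proof (cases "real u < m"; cases "real r < m")
        assume c: "real u < m" "real r < m"
        have "real s \<le> 4 * m" using c ur by simp
        then have "sqrt (real s) \<le> 2 * sqrt m" using real_sqrt_le_mono[of "real s" "4 * m"] by (simp add: real_sqrt_mult)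
        then have "sqrt (real s) * sqrt (real t) \<le> 2 * sqrt m * sqrt (real t)" by (intro mult_right_mono) auto
        then have "sqrt (real t / m) \<le> 2 * sqrt (real t / real s)"
          using m s1 by (simp add: real_sqrt_divide field_simps)
        then have "3 * sqrt (real t / m) \<le> 1 / 100 * (1 / 16 * exp 40 * sqrt (real t / real s))"
          using mult_right_mono[OF exp_40_ge, of "sqrt (real t / real s)"] by simp
        also have "\<dots> \<le> 1 / 100 * W" unfolding W_def using e40
          by (intro mult_left_mono mult_right_mono) auto
        also have "\<dots> \<le> k u * W" unfolding k_def r_def[symmetric] using k_parts W0
          by (intro mult_right_mono) linarith+
        finally show ?thesis using g_small[OF c(1)] h_small[OF c(2)] by (simp add: mult.commute)
      next
        assume c: "real u < m" "\<not> real r < m"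
        have "real s / real r = 1 + real u / real r" using ur by (simp add: field_simps)
        also have "\<dots> \<le> 1 + real u / m" using c m by (intro add_left_mono divide_left_mono) auto
        also have "\<dots> \<le> exp (real u / m)" by (rule exp_ge_add_one_self)
        finally have "real s / real r \<le> exp (real u / m)" .
        moreover have "sqrt (real s / real r) \<le> real s / real r"
          using ur by (intro real_le_lsqrt) (auto simp: power2_eq_square field_simps)
        ultimately have sr: "sqrt (real s / real r) \<le> exp (real u / m)" by linarith
        have "1 / 16 * exp (40 * real r / m) * sqrt (real t / real r)
          = W * (exp (- (40 * real u / m)) * sqrt (real s / real r))"
          using s1 ur(2) unfolding W_def exps exp_minus real_sqrt_divide by (simp add: field_simps)
        also have "\<dots> \<le> W * (exp (- (40 * real u / m)) * exp (real u / m))"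
          using sr W0 by (intro mult_left_mono) auto
        also have "\<dots> = W * exp (- (39 / m) * real u)"
          using m by (simp add: exp_add[symmetric] field_simps)
        also have "\<dots> \<le> W * k u" unfolding k_def r_def[symmetric] using k_parts W0
          by (intro mult_left_mono) linarith+
        finally show ?thesis using g_small[OF c(1)] h_large[OF c(2)] by simp
      next
        assume c: "\<not> real u < m" "real r < m"
        have "heavy_mgf m u u * heavy_mgf m r t \<le> (1 / 16 * exp (40 * real u / m)) * (3 * sqrt (real t / m))"
          using g_large[OF c(1)] h_small[OF c(2)] heavy_mgf_nonneg by (intro mult_mono) auto
        also have "\<dots> = W * (3 * sqrt (real s / m) * exp (- (40 / m) * real r))"
          using s1 m unfolding W_def exps mult_minus_left exp_minus real_sqrt_divide by (simp add: field_simps exp_minus)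
        also have "\<dots> \<le> W * (3 * (real s / m) * exp (- (40 / m) * real r))"
        proof -
          have "sqrt (real s / m) \<le> real s / m"
            using less.prems m by (intro real_le_lsqrt) (auto simp: power2_eq_square field_simps)
          then show ?thesis using W0 by (intro mult_left_mono mult_right_mono) auto
        qed
        also have "\<dots> \<le> W * k u" unfolding k_def r_def[symmetric] using k_parts W0
          by (intro mult_left_mono) linarith+
        finally show ?thesis .
      next
        assume c: "\<not> real u < m" "\<not> real r < m"
        have "heavy_mgf m u u * heavy_mgf m r t \<le>
          (1 / 16 * exp (40 * real u / m)) * (1 / 16 * exp (40 * real r / m) * sqrt (real t / real r))"
          using g_large[OF c(1)] h_large[OF c(2)] heavy_mgf_nonneg by (intro mult_mono) auto
        also have "\<dots> = W * (1 / 16 * sqrt (real s) * (1 / sqrt (real r)))"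
          using s1 ur(2) unfolding W_def exps real_sqrt_divide by (simp add: field_simps)
        also have "\<dots> \<le> W * k u" unfolding k_def r_def[symmetric] using k_parts W0
          by (intro mult_left_mono) linarith+
        finally show ?thesis .
      qed
      then show ?thesis by (simp add: r_def)
    qed
    have ms: "m \<le> 2 * real (s - 1)" "real s \<le> 2 * real (s - 1)"
      using less.prems s2 by (auto simp: of_nat_diff)
    have "(\<Sum>u = 1..s-1. k u) = (\<Sum>u = 1..s-1. exp (- (39 / m) * real u)) + real (s - 1) / 100
      + 1 / 16 * sqrt (real s) * (\<Sum>r = 1..s-1. 1 / sqrt (real r))
      + 3 * (real s / m) * (\<Sum>r = 1..s-1. exp (- (40 / m) * real r))"
      unfolding k_def sum.distrib sum_distrib_left[symmetric]
      using sum_reflect[of "\<lambda>r. 1 / sqrt (real r)" s] sum_reflect[of "\<lambda>r. exp (- (40 / m) * real r)" s]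
      by simp
    also have "\<dots> \<le> 1 / (39 / m) + real (s - 1) / 100 + 1 / 16 * sqrt (real s) * (2 * sqrt (real s))
      + 3 * (real s / m) * (1 / (40 / m))"
    proof (intro add_mono mult_left_mono)
      have "(\<Sum>r = 1..s-1. 1 / sqrt (real r)) \<le> 2 * sqrt (real (s - 1))" by (rule sum_inverse_sqrt_le)
      also have "\<dots> \<le> 2 * sqrt (real s)" by simp
      finally show "(\<Sum>r = 1..s-1. 1 / sqrt (real r)) \<le> 2 * sqrt (real s)" .
      show "(\<Sum>u = 1..s-1. exp (- (39 / m) * real u)) \<le> 1 / (39 / m)"
        "(\<Sum>r = 1..s-1. exp (- (40 / m) * real r)) \<le> 1 / (40 / m)"
        by (rule sum_exp_neg_le, use m in simp)+
    qed (use m in auto)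
    also have "\<dots> = m / 39 + real (s - 1) / 100 + real s / 8 + 3 * real s / 40" using m by simp
    also have "\<dots> \<le> 3 / 4 * real (s - 1)" using ms by linarith
    finally have ksum: "(\<Sum>u = 1..s-1. k u) \<le> 3 / 4 * real (s - 1)" .
    have "heavy_mgf m s t \<le> 4 / 3 * (\<Sum>u = 1..s-1. heavy_mgf m u u * heavy_mgf m (s - u) t) / real (s - 1)"
      by (rule heavy_mgf_rec[OF s2])
    also have "\<dots> \<le> 4 / 3 * (\<Sum>u = 1..s-1. W * k u) / real (s - 1)"
      using split by (intro divide_right_mono mult_left_mono sum_mono) auto
    also have "\<dots> = 4 / 3 * (W * (\<Sum>u = 1..s-1. k u)) / real (s - 1)" by (simp add: sum_distrib_left)
    also have "\<dots> \<le> 4 / 3 * (W * (3 / 4 * real (s - 1))) / real (s - 1)"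
      using ksum W0 by (intro divide_right_mono mult_left_mono) auto
    also have "\<dots> = W" using s2 by simp
    finally show ?thesis by (simp add: W_def)
  qed
qed

lemma exp_quarter_le: "exp (1 / 4) \<le> (4 / 3 :: real)"
proof -
  have "1 + (- (1 / 4)) \<le> exp (- (1 / 4) :: real)" by (rule exp_ge_add_one_self)
  then show ?thesis by (simp add: exp_minus field_simps)
qed

text \<open>
  Markov's inequality for the exponential moment with \<open>m = sqrt x * n\<close>; since \<open>exp (1 / 4) \<le> 4 / 3\<close>, the
  threshold \<open>164 / sqrt x\<close> leaves \<open>exp (- 1 / sqrt x)\<close>, which is far below what is needed.
\<close>

lemma prob_many_heavy_links:
  assumes x: "0 < x" and n: "1 \<le> sqrt x * real n" "n \<ge> 1" and x1: "x \<le> 1"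
  shows "measure_pmf.prob (rtree_law n) {T. 164 / sqrt x \<le> real (heavy_links (x * (real n)\<^sup>2) n T)} \<le> 2 * x"
proof -
  define m where "m = sqrt x * real n"
  define y where "y = 1 / sqrt x"
  have y0: "y > 0" using x by (simp add: y_def)
  have X: "x * (real n)\<^sup>2 = m\<^sup>2" using x by (simp add: m_def power_mult_distrib)
  have m: "m \<ge> 1" "m \<le> real n" using n x x1 by (auto simp: m_def mult_left_le_one_le)
  let ?F = "\<lambda>T. exp (- 41 * y) * (4 / 3) ^ heavy_links (m\<^sup>2) n T"
  have "measure_pmf.prob (rtree_law n) {T. 164 / sqrt x \<le> real (heavy_links (x * (real n)\<^sup>2) n T)} \<le> avg n ?F"
  proof (rule prob_rtree_law_le[OF n(2)])
    fix T assume "T \<in> {T. 164 / sqrt x \<le> real (heavy_links (x * (real n)\<^sup>2) n T)}"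
    then have h: "164 * y \<le> real (heavy_links (m\<^sup>2) n T)" using X by (simp add: y_def)
    let ?h = "heavy_links (m\<^sup>2) n T"
    have "exp (41 * y) \<le> exp (real ?h * (1 / 4))" using h by simp
    also have "\<dots> = exp (1 / 4) ^ ?h" by (rule exp_of_nat_mult)
    also have "\<dots> \<le> (4 / 3) ^ ?h" by (intro power_mono exp_quarter_le) simp
    finally show "1 \<le> ?F (shape T)" by (simp add: exp_minus field_simps)
  qed simp
  also have "\<dots> = exp (- 41 * y) * heavy_mgf m n n" by (simp add: avg_cmult heavy_mgf_def)
  also have "\<dots> \<le> exp (- 41 * y) * (1 / 16 * exp (40 * real n / m) * sqrt (real n / real n))"
    using m by (intro mult_left_mono heavy_mgf_large) auto
  also have "exp (- 41 * y) * (1 / 16 * exp (40 * real n / m) * sqrt (real n / real n)) = 1 / 16 * exp (- y)"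
  proof -
    have "exp (- 41 * y) * exp (40 * y) = exp (- y)" by (simp add: exp_add[symmetric])
    moreover have "40 * real n / m = 40 * y" using n by (simp add: m_def y_def)
    ultimately show ?thesis using n by simp
  qed
  also have "\<dots> \<le> exp (- y)" by simp
  also have "\<dots> \<le> 2 / y\<^sup>2"
  proof -
    have "1 + y + y\<^sup>2 / 2 \<le> exp y" using y0 by (intro exp_lower_Taylor_quadratic) simp
    then have "y\<^sup>2 / 2 \<le> exp y" using y0 by linarith
    then show ?thesis using y0 by (simp add: exp_minus field_simps)
  qed
  also have "\<dots> = 2 * x" using x by (simp add: y_def power_divide)
  finally show ?thesis .
qed

section \<open>The rank of the root\<close>

lemma rank_le_card_verts:
  assumes "\<sigma> \<in> decreasing_rankings t f" "r \<in> verts t"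
  shows "\<sigma> r \<le> card (verts t)"
  using assms by (auto simp: decreasing_rankings_def bij_betw_def)

text \<open>
  If \<open>sqrt x * n < 1\<close> there are fewer than \<open>1 / sqrt x\<close> vertices altogether. Otherwise all vertices that
  beat the root are children in heavy links, outside the two exceptional events.
\<close>

lemma prob_top_ranked_ge:
  assumes x: "0 < x" "x \<le> 1 / 16" and n: "n \<ge> 1"
  shows "1 - (10 * x + 4 * x * ln (1 / x)) \<le>
    measure_pmf.prob (ordered_random_recursive_tree n) {(t, \<sigma>). 1 \<in> top_ranked t \<sigma> \<lceil>165 / sqrt x\<rceil>}"
proof (cases "sqrt x * real n < 1")
  case True
  have "measure_pmf.prob (rtree_law n) UNIV \<le>
    measure_pmf.prob (ordered_random_recursive_tree n) {(t, \<sigma>). 1 \<in> top_ranked t \<sigma> \<lceil>165 / sqrt x\<rceil>}"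
  proof (rule prob_ordered_ge[OF n])
    fix T \<sigma> assume T: "T \<in> set_pmf (rtree_law n)"
      "\<sigma> \<in> decreasing_rankings (graph_of T) (jordan2 (graph_of T))"
    have "\<sigma> 1 \<le> n" using rank_le_card_verts[OF T(2), of 1] rtree_law_support(2)[OF T(1) n] n by simp
    also have "real n \<le> 165 / sqrt x" using True x by (simp add: field_simps)
    finally show "real (\<sigma> 1) \<le> 165 / sqrt x" by simp
  qed
  moreover have "ln (1 / x) \<ge> 0" using x by (intro ln_ge_zero) simp
  then have "0 \<le> 10 * x + 4 * x * ln (1 / x)" using x by simp
  ultimately show ?thesis by simp
next
  case False
  have sx: "sqrt x \<le> 1 / 4" using x real_sqrt_le_mono[of x "1/16"] by (simp add: real_sqrt_divide)
  have "1 \<le> sqrt x * real n" using False by simp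
  also have "\<dots> \<le> 1 / 4 * real n" using sx by (intro mult_right_mono) auto
  finally have n2: "n \<ge> 2" by simp
  let ?A = "{T. real (jordan2 (graph_of T) (root_of T)) < x * (real n)\<^sup>2}"
  let ?B = "{T. 164 / sqrt x \<le> real (heavy_links (x * (real n)\<^sup>2) n T)}"
  have "measure_pmf.prob (rtree_law n) (?A \<union> ?B) \<le>
    measure_pmf.prob (rtree_law n) ?A + measure_pmf.prob (rtree_law n) ?B"
    by (intro measure_Un_le) auto
  also have "\<dots> \<le> (8 * x + 4 * x * ln (1 / x)) + 2 * x"
    using x n n2 False by (intro add_mono prob_jordan2_root_small prob_many_heavy_links) auto
  finally have "1 - (10 * x + 4 * x * ln (1 / x)) \<le> measure_pmf.prob (rtree_law n) (- (?A \<union> ?B))"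
    using measure_pmf.prob_compl[of "?A \<union> ?B" "rtree_law n"] by (simp add: Compl_eq_Diff_UNIV)
  also have "\<dots> \<le> measure_pmf.prob (ordered_random_recursive_tree n)
    {(t, \<sigma>). 1 \<in> top_ranked t \<sigma> \<lceil>165 / sqrt x\<rceil>}"
  proof (rule prob_ordered_ge[OF n])
    fix T \<sigma> assume T: "T \<in> set_pmf (rtree_law n)" "T \<in> - (?A \<union> ?B)"
      "\<sigma> \<in> decreasing_rankings (graph_of T) (jordan2 (graph_of T))"
    have s: "distinct_verts T" "set_rtree T = {1..n}" "root_of T = 1" "vcount T = n"
      using rtree_law_support[OF T(1) n] vcount_rtree_law[OF T(1) n] by auto
    have "\<sigma> 1 \<le> card {v \<in> set_rtree T. jordan2 (graph_of T) 1 \<le> jordan2 (graph_of T) v}"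
      using ranking_le_card[OF T(3), of 1] s(2) n by simp
    also have "\<dots> \<le> Suc (heavy_links (x * (real n)\<^sup>2) n T)"
      using card_jordan2_ge[OF s(1), of "x * (real n)\<^sup>2"] T(2) s(3,4) by simp
    finally have "real (\<sigma> 1) \<le> real (Suc (heavy_links (x * (real n)\<^sup>2) n T))" by (simp only: of_nat_le_iff)
    also have "\<dots> \<le> 1 + 164 / sqrt x" using T(2) by simp
    also have "\<dots> \<le> 1 / sqrt x + 164 / sqrt x"
    proof (rule add_right_mono)
      show "1 \<le> 1 / sqrt x" using x sx by simp
    qed
    also have "\<dots> = 165 / sqrt x" by (simp add: add_divide_distrib[symmetric])
    finally show "real (\<sigma> 1) \<le> 165 / sqrt x" .
  qed
  finally show ?thesis .
qed

lemma kids_attach_root: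
  assumes "distinct_verts T"
  shows "kids (attach (root_of T) w T) = kids T @ [Single w]"
  using assms
proof (induction T)
  case (Join c t)
  then have "root_of t \<notin> set_rtree c" using root_in_verts[of t] by (auto simp del: root_in_verts)
  then show ?case using Join by (simp add: attach_notin)
qed simp

text \<open>
  Attaching every vertex to the root gives a star.
\<close>

lemma exists_star:
  assumes "n \<ge> 1"
  shows "\<exists>T \<in> set_pmf (rtree_law n). \<forall>a \<in> set (kids T). vcount a = 1"
  using assms
proof (induction n rule: rtree_law.induct)
  case (3 m)
  then obtain T where T: "T \<in> set_pmf (rtree_law (Suc m))" "\<forall>a \<in> set (kids T). vcount a = 1" by auto
  have s: "distinct_verts T" "root_of T = 1" using rtree_law_support[OF T(1)] by auto
  have "attach 1 (Suc (Suc m)) T \<in> set_pmf (rtree_law (Suc (Suc m)))"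
    using T(1) by (auto intro!: bexI[of _ T])
  moreover have "\<forall>a \<in> set (kids (attach 1 (Suc (Suc m)) T)). vcount a = 1"
    using kids_attach_root[OF s(1), of "Suc (Suc m)"] s(2) T(2) by auto
  ultimately show ?case by blast
qed auto

lemma prob_root_first_pos:
  assumes n: "n \<ge> 1"
  shows "0 < measure_pmf.prob (ordered_random_recursive_tree n) {(t, \<sigma>). 1 \<in> top_ranked t \<sigma> 1}"
proof -
  obtain T where T: "T \<in> set_pmf (rtree_law n)" "\<forall>a \<in> set (kids T). vcount a = 1"
    using exists_star[OF n] by blast
  have s: "distinct_verts T" "set_rtree T = {1..n}" "root_of T = 1" "vcount T = n"
    using rtree_law_support[OF T(1) n] vcount_rtree_law[OF T(1) n] by auto
  have max: "jordan2 (graph_of T) v \<le> jordan2 (graph_of T) 1" if v: "v \<in> set_rtree T" for v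
  proof (cases "v = 1")
    case False
    then have n2: "n \<ge> 2" using v s(2) by simp
    have "jordan2 (graph_of T) v \<le> 1 * (n - 1)" "(n - 1)\<^sup>2 \<le> jordan2 (graph_of T) 1"
      using jordan2_root_max[OF s(1), of 1 v] T(2) s(3,4) n2 v False by auto
    moreover have "1 * (n - 1) \<le> (n - 1)\<^sup>2" using n2 by (simp add: power2_eq_square)
    ultimately show ?thesis by linarith
  qed simp
  obtain \<sigma> where \<sigma>: "\<sigma> \<in> decreasing_rankings (graph_of T) (jordan2 (graph_of T))" "\<sigma> 1 = 1"
    using exists_decreasing_ranking[of "graph_of T" 1 "jordan2 (graph_of T)"] max s(2) n by auto
  have "set_rtree T \<noteq> {}" using root_in_verts[of T] by blast
  then have "\<sigma> \<in> set_pmf (jordan2_ordering (graph_of T))"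
    using \<sigma>(1) set_jordan2_ordering[of "graph_of T"] by simp
  then have "(graph_of T, \<sigma>) \<in> set_pmf (ordered_random_recursive_tree n)"
    using T(1) n by (auto simp: ordered_random_recursive_tree_def random_recursive_tree_eq)
  then show ?thesis using \<sigma>(2) s(2) n by (intro measure_pmf_posI) (auto simp: top_ranked_def)
qed

lemma ln_50_19_le: "ln (50 / 19) \<le> (98 / 100 :: real)"
proof -
  \<comment> \<open>Here \<open>50 / 19 = 1 / 0.38\<close> and \<open>98 / 100 = 4 * (49 / 200)\<close>.\<close>
  have "(50 / 19 :: real) \<le> (1 + 49 / 200 + (49 / 200)\<^sup>2 / 2) ^ 4" by (simp add: power_divide)
  also have "\<dots> \<le> exp (49 / 200) ^ 4" by (intro power_mono exp_lower_Taylor_quadratic) auto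
  also have "\<dots> = exp (98 / 100)" by (simp add: exp_of_nat_mult[symmetric])
  finally have "ln (50 / 19) \<le> ln (exp (98 / 100) :: real)" by (intro ln_mono) auto
  then show ?thesis by (simp only: ln_exp)
qed

text \<open>
  The expected number of branches with at least \<open>0.38 * n\<close> vertices is about \<open>ln (1 / 0.38) < 1\<close>, so with
  positive probability there is none. Then the root wins outright, because \<open>0.38 < (1 - 0.38)\<^sup>2\<close>. From \<open>n = 300\<close> on,
  the error from rounding \<open>0.38 * n\<close> is at most \<open>1 / 100\<close>.
\<close>

lemma prob_root_first_large:
  assumes n: "n \<ge> 300"
  shows "1 / 100 \<le> measure_pmf.prob (ordered_random_recursive_tree n) {(t, \<sigma>). 1 \<in> top_ranked t \<sigma> \<lceil>1::real\<rceil>}"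
proof -
  let ?B = "{T. \<exists>a \<in> set (kids T). 19 / 50 * real n \<le> real (vcount a)}"
  have "measure_pmf.prob (rtree_law n) ?B \<le> avg n (\<lambda>T. \<Sum>a\<leftarrow>kids T. of_bool (19 / 50 * real n \<le> real (vcount a)))"
  proof (rule prob_rtree_law_le)
    fix T :: "nat rtree" assume "T \<in> ?B"
    then obtain a where "a \<in> set (kids T)" "19 / 50 * real n \<le> real (vcount a)" by blast
    then show "1 \<le> (\<Sum>a\<leftarrow>kids (shape T). of_bool (19 / 50 * real n \<le> real (vcount a)) :: real)"
      by (intro member_le_sum_list[THEN order_trans[rotated]]) force+
  qed (use n in \<open>auto intro!: sum_list_nonneg\<close>)
  also have "\<dots> = (\<Sum>s = 1..n-1. avg s (\<lambda>a. of_bool (19 / 50 * real n \<le> real (vcount a))) / real s)"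
    using n by (intro avg_kids) auto
  also have "\<dots> = (\<Sum>s = 1..n-1. if 19 / 50 * real n \<le> real s then 1 / real s else 0)"
  proof (rule sum.cong[OF refl])
    fix s assume s: "s \<in> {1..n-1}"
    have "avg s (\<lambda>a. of_bool (19 / 50 * real n \<le> real (vcount a))) = avg s (\<lambda>a. of_bool (19 / 50 * real n \<le> real s))"
      using s by (intro avg_cong) auto
    then show "avg s (\<lambda>a. of_bool (19 / 50 * real n \<le> real (vcount a))) / real s =
      (if 19 / 50 * real n \<le> real s then 1 / real s else 0)" by simp
  qed
  also have "\<dots> = (\<Sum>s \<in> {s \<in> {1..n-1}. 19 / 50 * real n \<le> real s}. 1 / real s)"
    by (intro sum.inter_filter[symmetric]) simp
  also have "\<dots> \<le> (\<Sum>s = nat \<lceil>19 / 50 * real n\<rceil>..n. 1 / real s)"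
    by (intro sum_mono2) (auto simp: nat_le_iff ceiling_le_iff)
  also have "\<dots> \<le> 1 / real (nat \<lceil>19 / 50 * real n\<rceil>) + ln (real n / real (nat \<lceil>19 / 50 * real n\<rceil>))"
    using n by (intro sum_inverse_le_ln) (auto simp: nat_le_iff ceiling_le_iff le_nat_iff le_ceiling_iff)
  also have "\<dots> \<le> 1 / 100 + ln (50 / 19)"
  proof (intro add_mono)
    have a: "19 / 50 * real n \<le> real (nat \<lceil>19 / 50 * real n\<rceil>)" by (rule real_nat_ceiling_ge)
    have b: "100 \<le> 19 / 50 * real n" using n by simp
    show "1 / real (nat \<lceil>19 / 50 * real n\<rceil>) \<le> 1 / 100" using a b by (intro divide_left_mono) auto
    have "0 < real (nat \<lceil>19 / 50 * real n\<rceil>)" using a b by linarith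
    moreover have "real n \<le> 50 / 19 * real (nat \<lceil>19 / 50 * real n\<rceil>)" using a by linarith
    ultimately have "real n / real (nat \<lceil>19 / 50 * real n\<rceil>) \<le> 50 / 19" "0 < real n / real (nat \<lceil>19 / 50 * real n\<rceil>)"
      using n pos_divide_le_eq by (blast, simp)
    then show "ln (real n / real (nat \<lceil>19 / 50 * real n\<rceil>)) \<le> ln (50 / 19)" by (intro ln_mono) auto
  qed
  also have "\<dots> \<le> 99 / 100" using ln_50_19_le by simp
  finally have "1 / 100 \<le> measure_pmf.prob (rtree_law n) (- ?B)"
    using measure_pmf.prob_compl[of ?B "rtree_law n"] by (simp add: Compl_eq_Diff_UNIV)
  also have "\<dots> \<le> measure_pmf.prob (ordered_random_recursive_tree n) {(t, \<sigma>). 1 \<in> top_ranked t \<sigma> \<lceil>1::real\<rceil>}"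
  proof (rule prob_ordered_ge)
    fix T \<sigma> assume T: "T \<in> set_pmf (rtree_law n)" "T \<in> - ?B"
      "\<sigma> \<in> decreasing_rankings (graph_of T) (jordan2 (graph_of T))"
    have s: "distinct_verts T" "set_rtree T = {1..n}" "root_of T = 1" "vcount T = n"
      using rtree_law_support[OF T(1)] vcount_rtree_law[OF T(1)] n by auto
    define M where "M = Max (insert 0 (vcount ` set (kids T)))"
    have "M \<in> insert 0 (vcount ` set (kids T))" unfolding M_def by (intro Max_in) auto
    then have M: "real M < 19 / 50 * real n" using T(2) n by auto
    have kids_le: "\<forall>a \<in> set (kids T). vcount a \<le> M" by (auto simp: M_def)
    have "M \<le> n" using M by simp
    have "31 / 50 * real n \<le> real (n - M)" using M \<open>M \<le> n\<close> by (simp add: of_nat_diff)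
    have "real M * real n \<le> 19 / 50 * real n * real n" using M by (intro mult_right_mono) auto
    also have "\<dots> < (31 / 50 * real n)\<^sup>2" using n by (simp add: power2_eq_square)
    also have "\<dots> \<le> (real (n - M))\<^sup>2"
      using \<open>31 / 50 * real n \<le> real (n - M)\<close> by (intro power_mono) auto
    finally have "real (M * n) < real ((n - M)\<^sup>2)" by simp
    then have Mn: "M * n < (n - M)\<^sup>2" by (simp only: of_nat_less_iff)
    have "{v \<in> set_rtree T. jordan2 (graph_of T) 1 \<le> jordan2 (graph_of T) v} \<subseteq> {1}"
    proof
      fix v assume v: "v \<in> {v \<in> set_rtree T. jordan2 (graph_of T) 1 \<le> jordan2 (graph_of T) v}"
      show "v \<in> {1}"
      proof (rule ccontr)
        assume "v \<notin> {1}"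
        then have "jordan2 (graph_of T) v \<le> M * (n - 1)" "(n - M)\<^sup>2 \<le> jordan2 (graph_of T) 1"
          using jordan2_root_max[OF s(1) _ kids_le, of v] s(3,4) n v by auto
        moreover have "M * (n - 1) \<le> M * n" by simp
        moreover have "jordan2 (graph_of T) 1 \<le> jordan2 (graph_of T) v" using v by simp
        ultimately show False using Mn by linarith
      qed
    qed
    then have "card {v \<in> set_rtree T. jordan2 (graph_of T) 1 \<le> jordan2 (graph_of T) v} \<le> 1"
      using card_mono[of "{1::nat}"] by fastforce
    then show "real (\<sigma> 1) \<le> 1" using ranking_le_card[OF T(3), of 1] s(2) n by simp
  qed (use n in auto)
  finally show ?thesis .
qed

text \<open>
  For \<open>\<epsilon>\<close> close to \<open>1\<close> the set consists of a single vertex, so a lower bound that is uniform in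
  \<open>n\<close> is needed for the probability that the root has rank \<open>1\<close>. Stars provide it for small \<open>n\<close>.
\<close>

lemma prob_root_first_bound:
  "\<exists>c>0. c < 1 \<and> (\<forall>n\<ge>1. c \<le> measure_pmf.prob (ordered_random_recursive_tree n)
     {(t, \<sigma>). 1 \<in> top_ranked t \<sigma> 1})"
proof -
  let ?e = "\<lambda>n. measure_pmf.prob (ordered_random_recursive_tree n) {(t, \<sigma>). 1 \<in> top_ranked t \<sigma> 1}"
  define c where "c = Min (insert (1 / 100) (?e ` {1..300}))"
  have "c > 0" unfolding c_def using prob_root_first_pos by (subst Min_gr_iff) auto
  moreover have "c \<le> 1 / 100" unfolding c_def by (intro Min_le) auto
  moreover have "c \<le> ?e n" if "n \<ge> 1" for n
  proof (cases "n \<le> 300")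
    case True then show ?thesis unfolding c_def using that by (intro Min_le) auto
  next
    case False
    then have "1 / 100 \<le> ?e n" using prob_root_first_large[of n] by simp
    then show ?thesis using \<open>c \<le> 1 / 100\<close> by linarith
  qed
  ultimately show ?thesis by (intro exI[of _ c]) auto
qed

lemma prob_top_ranked_mono:
  assumes "k \<le> l"
  shows "measure_pmf.prob p {(t, \<sigma>). v \<in> top_ranked t \<sigma> k} \<le> measure_pmf.prob p {(t, \<sigma>). v \<in> top_ranked t \<sigma> l}"
  using assms by (intro measure_pmf.finite_measure_mono) (auto simp: top_ranked_def)

lemma ln_100_le: "ln 100 \<le> (7::real)"
proof -
  have "(100::real) \<le> 2 ^ 7" by simp
  also have "\<dots> \<le> exp 1 ^ 7" using exp_ge_add_one_self[of 1] by (intro power_mono) auto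
  also have "\<dots> = exp 7" by (simp add: exp_of_nat_mult[symmetric])
  finally have "ln 100 \<le> ln (exp 7 :: real)" by (intro ln_mono) auto
  then show ?thesis by (simp only: ln_exp)
qed

text \<open>
  The choice \<open>x = \<epsilon> / (100 * L)\<close> with \<open>L = ln (1 / \<epsilon>) \<ge> 1\<close> turns the error \<open>x * ln (1 / x)\<close>, which is of
  order \<open>x * L\<close>, into a fraction of \<open>\<epsilon>\<close>, while \<open>1 / sqrt x\<close> has the required order.
\<close>

lemma prob_top_ranked_small_eps:
  assumes eps: "0 < \<epsilon>" "\<epsilon> \<le> exp (- 1)" and n: "n \<ge> 1"
  shows "1 - \<epsilon> \<le> measure_pmf.prob (ordered_random_recursive_tree n)
    {(t, \<sigma>). 1 \<in> top_ranked t \<sigma> \<lceil>1650 * sqrt (ln (1 / \<epsilon>) / \<epsilon>)\<rceil>}"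
proof -
  define L where "L = ln (1 / \<epsilon>)"
  define x where "x = \<epsilon> / (100 * L)"
  have "ln (1 / exp (- 1)) \<le> L"
    unfolding L_def using eps by (intro ln_mono) (auto intro!: divide_left_mono)
  then have L1: "L \<ge> 1" by (simp add: ln_div)
  have "\<epsilon> \<le> 1" using eps(2) by (rule order_trans) simp
  have "\<epsilon> / (100 * L) \<le> \<epsilon> / 100" using eps L1 by (intro divide_left_mono) auto
  then have x: "0 < x" "x \<le> 1 / 16" "x \<le> \<epsilon> / 100" using eps L1 \<open>\<epsilon> \<le> 1\<close> by (auto simp: x_def)
  have "ln (1 / x) = ln (100 * (L * (1 / \<epsilon>)))" by (simp add: x_def)
  also have "\<dots> = ln 100 + (ln L + ln (1 / \<epsilon>))" using eps L1 by (simp add: ln_mult ln_div)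
  also have "\<dots> = ln 100 + L + ln L" by (simp add: L_def)
  also have "\<dots> \<le> 7 * L + L + L" using ln_100_le ln_le_minus_one[of L] L1 by linarith
  finally have "10 * x + 4 * x * ln (1 / x) \<le> 10 * x + 4 * x * (9 * L)"
    using x by (intro add_left_mono mult_left_mono) auto
  also have "\<dots> = 10 * x + 36 / 100 * \<epsilon>" using L1 by (simp add: x_def field_simps)
  also have "\<dots> \<le> \<epsilon>" using x eps by linarith
  finally have "1 - \<epsilon> \<le> 1 - (10 * x + 4 * x * ln (1 / x))" by simp
  also have "\<dots> \<le> measure_pmf.prob (ordered_random_recursive_tree n)
    {(t, \<sigma>). 1 \<in> top_ranked t \<sigma> \<lceil>165 / sqrt x\<rceil>}" by (rule prob_top_ranked_ge[OF x(1,2) n])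
  also have "165 / sqrt x = 1650 * sqrt (L / \<epsilon>)"
    using eps L1 by (simp add: x_def real_sqrt_divide real_sqrt_mult)
  finally show ?thesis by (simp add: L_def)
qed

text \<open>
  For \<open>\<epsilon> \<le> exp (- 1)\<close> the preceding lemma applies directly and for \<open>\<epsilon>\<close> above \<open>1 - c\<close> a single vertex is
  enough. In between, \<open>C\<close> is chosen so large that the set contains the one for \<open>\<epsilon> = exp (- 1)\<close>.
\<close>

theorem corollary1p4:
  "\<exists>C::real. C > 0 \<and>
     (\<forall>n::nat. \<forall>\<epsilon>::real. n \<ge> 1 \<longrightarrow> 0 < \<epsilon> \<longrightarrow> \<epsilon> < 1 \<longrightarrow>
        measure_pmf.prob (ordered_random_recursive_tree n)
          {(t, \<sigma>). 1 \<in> top_ranked t \<sigma> \<lceil>C * sqrt (ln (1 / \<epsilon>) / \<epsilon>)\<rceil>} \<ge> 1 - \<epsilon>)"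
proof -
  obtain c where c: "c > 0" "c < 1"
    "\<And>n. n \<ge> 1 \<Longrightarrow> c \<le> measure_pmf.prob (ordered_random_recursive_tree n)
       {(t, \<sigma>). 1 \<in> top_ranked t \<sigma> 1}" using prob_root_first_bound by blast
  define C where "C = 1650 * sqrt (exp 1) / sqrt c"
  let ?P = "\<lambda>n k. measure_pmf.prob (ordered_random_recursive_tree n) {(t, \<sigma>). 1 \<in> top_ranked t \<sigma> k}"
  have "1 * 1 \<le> sqrt (exp 1) * (1 / sqrt c)" using c(1,2) by (intro mult_mono) auto
  then have C: "C \<ge> 1650" by (simp add: C_def)
  have "1 - \<epsilon> \<le> ?P n \<lceil>C * sqrt (ln (1 / \<epsilon>) / \<epsilon>)\<rceil>"
    if n: "n \<ge> 1" and eps: "0 < \<epsilon>" "\<epsilon> < 1" for n and \<epsilon> :: real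
  proof -
    have L0: "ln (1 / \<epsilon>) > 0" using eps by simp
    consider "\<epsilon> \<le> exp (- 1)" | "exp (- 1) < \<epsilon>" "\<epsilon> \<le> 1 - c" | "1 - c < \<epsilon>" by linarith
    then show ?thesis
    proof cases
      case 1
      have "1 - \<epsilon> \<le> ?P n \<lceil>1650 * sqrt (ln (1 / \<epsilon>) / \<epsilon>)\<rceil>"
        by (rule prob_top_ranked_small_eps[OF eps(1) 1 n])
      also have "\<dots> \<le> ?P n \<lceil>C * sqrt (ln (1 / \<epsilon>) / \<epsilon>)\<rceil>"
        using C eps L0 by (intro prob_top_ranked_mono ceiling_mono mult_right_mono) auto
      finally show ?thesis .
    next
      case 2
      have "c \<le> ln (1 / \<epsilon>)"
      proof -
        have "ln \<epsilon> \<le> \<epsilon> - 1" using eps by (intro ln_le_minus_one)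
        then show ?thesis using 2(2) eps by (simp add: ln_div)
      qed
      also have "\<dots> \<le> ln (1 / \<epsilon>) / \<epsilon>"
        using divide_left_mono[of \<epsilon> 1 "ln (1 / \<epsilon>)"] eps L0 by simp
      finally have "sqrt c \<le> sqrt (ln (1 / \<epsilon>) / \<epsilon>)" by simp
      then have "C * sqrt c \<le> C * sqrt (ln (1 / \<epsilon>) / \<epsilon>)" using C by (intro mult_left_mono) auto
      moreover have "C * sqrt c = 1650 * sqrt (exp 1)" using c(1) by (simp add: C_def)
      ultimately have le: "1650 * sqrt (exp 1) \<le> C * sqrt (ln (1 / \<epsilon>) / \<epsilon>)" by simp
      have "1 - \<epsilon> \<le> 1 - exp (- 1)" using 2(1) by simp
      also have "\<dots> \<le> ?P n \<lceil>1650 * sqrt (ln (1 / exp (- 1)) / exp (- 1))\<rceil>"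
        by (rule prob_top_ranked_small_eps[OF _ _ n]) auto
      also have "ln (1 / exp (- 1)) / exp (- 1) = exp (1 :: real)" by (simp add: exp_minus divide_inverse)
      also have "?P n \<lceil>1650 * sqrt (exp 1)\<rceil> \<le> ?P n \<lceil>C * sqrt (ln (1 / \<epsilon>) / \<epsilon>)\<rceil>"
        using le by (intro prob_top_ranked_mono ceiling_mono)
      finally show ?thesis .
    next
      case 3
      have "1 - \<epsilon> \<le> ?P n 1" using c(3)[OF n] 3 by linarith
      also have "\<dots> \<le> ?P n \<lceil>C * sqrt (ln (1 / \<epsilon>) / \<epsilon>)\<rceil>"
        using C eps L0 by (intro prob_top_ranked_mono) (simp add: one_le_ceiling)
      finally show ?thesis .
    qed
  qed
  moreover have "C > 0" using C by simp
  ultimately show ?thesis by blast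
qed

end
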